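(* Let $R$ be a semilocal ring whose Jacobson radical $J(R)$ is locally nilpotent, and let $G$ be a locally finite group. Then the group ring $RG$ is strongly unit nil-clean.
   Context: Rings are associative with identity, not necessarily commutative. An element of a ring is strongly nil-clean if it is the sum of an idempotent $e$ and a nilpotent $b$ with $eb=be$. A ring $S$ is strongly unit nil-clean if for every $a\in S$ there is a unit $u\in S$ such that $ua$ is strongly nil-clean. $R$ is semilocal if $R/J(R)$ is semisimple (Artinian). An ideal is locally nilpotent if every finite subset of it generates a nilpotent subring without identity. A group is locally finite if each of its finitely generated subgroups is finite. *)

theory Defs
  imports "HOL-Algebra.Algebra"
begin

section \<open>Strongly unit nil-clean rings\<close>

definition nilpotent_elem :: "('a, 'b) ring_scheme \<Rightarrow> 'a \<Rightarrow> bool" where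
  "nilpotent_elem R b \<longleftrightarrow> b \<in> carrier R \<and> (\<exists>n::nat. b [^]\<^bsub>R\<^esub> n = \<zero>\<^bsub>R\<^esub>)"

definition idempotent_elem :: "('a, 'b) ring_scheme \<Rightarrow> 'a \<Rightarrow> bool" where
  "idempotent_elem R e \<longleftrightarrow> e \<in> carrier R \<and> e \<otimes>\<^bsub>R\<^esub> e = e"

definition strongly_nil_clean_elem :: "('a, 'b) ring_scheme \<Rightarrow> 'a \<Rightarrow> bool" where
  "strongly_nil_clean_elem R a \<longleftrightarrow>
     (\<exists>e b. idempotent_elem R e \<and> nilpotent_elem R b \<and>
            e \<otimes>\<^bsub>R\<^esub> b = b \<otimes>\<^bsub>R\<^esub> e \<and> a = e \<oplus>\<^bsub>R\<^esub> b)"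

definition strongly_unit_nil_clean :: "('a, 'b) ring_scheme \<Rightarrow> bool" where
  "strongly_unit_nil_clean S \<longleftrightarrow>
     (\<forall>a \<in> carrier S. \<exists>u \<in> Units S. strongly_nil_clean_elem S (u \<otimes>\<^bsub>S\<^esub> a))"


section \<open>Jacobson radical and semilocal rings\<close>

text \<open>The ideals of the HOL-Algebra library are two-sided, and its modules are over
  commutative rings only; over a noncommutative ring the submodules of the regular left
  module are the left ideals.\<close>

locale left_ideal = additive_subgroup I R + ring R for I and R (structure) +
  assumes I_l_closed: "\<lbrakk>a \<in> I; x \<in> carrier R\<rbrakk> \<Longrightarrow> x \<otimes> a \<in> I"

definition maximal_left_ideal :: "'a set \<Rightarrow> ('a, 'b) ring_scheme \<Rightarrow> bool" where
  "maximal_left_ideal M R \<longleftrightarrow>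
     left_ideal M R \<and> M \<noteq> carrier R \<and>
     (\<forall>I. left_ideal I R \<and> M \<subseteq> I \<longrightarrow> I = M \<or> I = carrier R)"

text \<open>Intersecting with the carrier only matters for the zero ring, which has no maximal
  left ideals and is its own radical.\<close>

definition jacobson_radical :: "('a, 'b) ring_scheme \<Rightarrow> 'a set" where
  "jacobson_radical R = carrier R \<inter> \<Inter> {M. maximal_left_ideal M R}"

text \<open>The regular left module is semisimple: each of its submodules is a direct summand.
  For a ring with identity this entails that the ring is (left and right) Artinian.\<close>

definition semisimple_ring :: "('a, 'b) ring_scheme \<Rightarrow> bool" where
  "semisimple_ring R \<longleftrightarrow>
     ring R \<and>
     (\<forall>I. left_ideal I R \<longrightarrow>
        (\<exists>K. left_ideal K R \<and> I \<inter> K = {\<zero>\<^bsub>R\<^esub>} \<and> I <+>\<^bsub>R\<^esub> K = carrier R))"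

definition semilocal_ring :: "('a, 'b) ring_scheme \<Rightarrow> bool" where
  "semilocal_ring R \<longleftrightarrow> ring R \<and> semisimple_ring (R Quot (jacobson_radical R))"


section \<open>Local nilpotence\<close>

inductive_set generate_rng :: "('a, 'b) ring_scheme \<Rightarrow> 'a set \<Rightarrow> 'a set"
  for R and F where
    zero: "\<zero>\<^bsub>R\<^esub> \<in> generate_rng R F"
  | incl: "h \<in> F \<Longrightarrow> h \<in> generate_rng R F"
  | a_inv: "h \<in> generate_rng R F \<Longrightarrow> \<ominus>\<^bsub>R\<^esub> h \<in> generate_rng R F"
  | eng_add: "\<lbrakk>h1 \<in> generate_rng R F; h2 \<in> generate_rng R F\<rbrakk> \<Longrightarrow>
      h1 \<oplus>\<^bsub>R\<^esub> h2 \<in> generate_rng R F"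
  | eng_mult: "\<lbrakk>h1 \<in> generate_rng R F; h2 \<in> generate_rng R F\<rbrakk> \<Longrightarrow>
      h1 \<otimes>\<^bsub>R\<^esub> h2 \<in> generate_rng R F"

text \<open>\<open>S\<^sup>n = 0\<close> for some \<open>n \<ge> 1\<close>: all products of \<open>n\<close> elements of \<open>S\<close> vanish.\<close>

definition nilpotent_rng :: "('a, 'b) ring_scheme \<Rightarrow> 'a set \<Rightarrow> bool" where
  "nilpotent_rng R S \<longleftrightarrow>
     (\<exists>n\<ge>1. \<forall>xs. set xs \<subseteq> S \<and> length xs = n \<longrightarrow> foldr (\<otimes>\<^bsub>R\<^esub>) xs \<one>\<^bsub>R\<^esub> = \<zero>\<^bsub>R\<^esub>)"

definition locally_nilpotent :: "('a, 'b) ring_scheme \<Rightarrow> 'a set \<Rightarrow> bool" where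
  "locally_nilpotent R I \<longleftrightarrow>
     (\<forall>F. finite F \<and> F \<subseteq> I \<longrightarrow> nilpotent_rng R (generate_rng R F))"


section \<open>Locally finite groups and group rings\<close>

definition locally_finite_group :: "('g, 'h) monoid_scheme \<Rightarrow> bool" where
  "locally_finite_group G \<longleftrightarrow>
     group G \<and> (\<forall>F. finite F \<and> F \<subseteq> carrier G \<longrightarrow> finite (generate G F))"

definition group_ring_supp ::
    "('a, 'b) ring_scheme \<Rightarrow> ('g, 'h) monoid_scheme \<Rightarrow> ('g \<Rightarrow> 'a) \<Rightarrow> 'g set" where
  "group_ring_supp R G f = {x \<in> carrier G. f x \<noteq> \<zero>\<^bsub>R\<^esub>}"

text \<open>The formal sum of the \<open>f x \<cdot> x\<close> is represented by its coefficient function \<open>f\<close>;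
  coefficient functions are extensional, that is, \<open>undefined\<close> off the carrier of \<open>G\<close>.
  The coefficient of a product at \<open>x\<close> sums \<open>f y \<cdot> g z\<close> over all \<open>y z = x\<close>.\<close>

definition group_ring ::
    "('a, 'b) ring_scheme \<Rightarrow> ('g, 'h) monoid_scheme \<Rightarrow> ('g \<Rightarrow> 'a) ring" where
  "group_ring R G =
    \<lparr>carrier = {f \<in> carrier G \<rightarrow>\<^sub>E carrier R. finite (group_ring_supp R G f)},
     monoid.mult = (\<lambda>f g. \<lambda>x\<in>carrier G.
       \<Oplus>\<^bsub>R\<^esub>y \<in> group_ring_supp R G f. f y \<otimes>\<^bsub>R\<^esub> g (inv\<^bsub>G\<^esub> y \<otimes>\<^bsub>G\<^esub> x)),
     one = (\<lambda>x\<in>carrier G. if x = \<one>\<^bsub>G\<^esub> then \<one>\<^bsub>R\<^esub> else \<zero>\<^bsub>R\<^esub>),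
     ring.zero = (\<lambda>x\<in>carrier G. \<zero>\<^bsub>R\<^esub>),
     add = (\<lambda>f g. \<lambda>x\<in>carrier G. f x \<oplus>\<^bsub>R\<^esub> g x)\<rparr>"

end

theory Submission
  imports Defs
begin

text \<open>
  An element of \<open>RG\<close> lies in \<open>RH\<close> for a finite subgroup \<open>H\<close>, so let \<open>G\<close> be finite. The map
  \<open>RG \<rightarrow> (R/J)G\<close>, \<open>J = J(R)\<close>, has a nil kernel: the coefficients of the \<open>n\<close>-th power of an
  element are sums of products of \<open>n\<close> of its finitely many coefficients, which lie in \<open>J\<close>. Along
  a surjection with nil kernel units lift, and so does strong nil-cleanness, because \<open>x\<close> is
  strongly nil-clean iff \<open>x (1 - x)\<close> is nilpotent.

  The ring \<open>T = (R/J)G\<close> is a finitely generated left module over a semisimple ring, hence has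
  both chain conditions on left ideals. Fitting's lemma for the right multiplication by \<open>a\<close> on
  \<open>T\<close> gives an idempotent \<open>e\<close> commuting with \<open>a\<close> such that \<open>a e\<close> is invertible in \<open>e T e\<close>, with
  inverse \<open>b\<close> say, and \<open>a (1 - e)\<close> is nilpotent. Then \<open>u = b + (1 - e)\<close> is a unit and
  \<open>u a = e + a (1 - e)\<close>.
\<close>

section \<open>Strongly nil-clean elements\<close>

context ring
begin

text \<open>The \<open>algebra\<close> method has no rule for \<open>x \<otimes> \<one>\<close> in noncommutative rings.\<close>

declare r_one [algebra ring "ring.zero R" "add R" "a_inv R" "a_minus R" "monoid.one R" "monoid.mult R"]

section \<open>Strongly nil-clean elements and nilpotence of \<open>x (1 - x)\<close>\<close>

text \<open>The witness is the geometric sum of the powers \<open>(1 - t)^i\<close> with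
  \<open>i < k\<close>, built up term by term. Being a polynomial in \<open>t\<close>, it commutes
  with whatever commutes with \<open>t\<close>; the extra element \<open>x\<close> keeps track of
  this.\<close>

lemma one_minus_one_minus_pow:
  assumes t: "t \<in> carrier R" "x \<in> carrier R" "t \<otimes> x = x \<otimes> t"
  shows "\<exists>p \<in> carrier R. p \<otimes> x = x \<otimes> p \<and> p \<otimes> t = t \<otimes> p \<and> \<one> \<ominus> (\<one> \<ominus> t) [^] (k::nat) = t \<otimes> p"
proof (induction k)
  case 0
  show ?case using t by (intro bexI[of _ \<zero>]) auto
next
  case (Suc k)
  then obtain p where p: "p \<in> carrier R" "p \<otimes> x = x \<otimes> p" "p \<otimes> t = t \<otimes> p"
    "\<one> \<ominus> (\<one> \<ominus> t) [^] k = t \<otimes> p" by blast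
  define q where "q = (\<one> \<ominus> t) [^] k"
  have tx: "(\<one> \<ominus> t) \<otimes> x = x \<otimes> (\<one> \<ominus> t)" "(\<one> \<ominus> t) \<otimes> t = t \<otimes> (\<one> \<ominus> t)"
    by (insert t; algebra)+
  have q: "q \<in> carrier R" "q \<otimes> x = x \<otimes> q" "q \<otimes> t = t \<otimes> q"
    unfolding q_def using t tx by (auto intro!: group_commutes_pow)
  have "\<one> \<ominus> q \<otimes> (\<one> \<ominus> t) = (\<one> \<ominus> q) \<oplus> q \<otimes> t"
    using q t by algebra
  also have "\<dots> = t \<otimes> (p \<oplus> q)"
    using p q t by (simp add: q_def[symmetric] r_distr)
  finally show ?case
    using p q t by (intro bexI[of _ "p \<oplus> q"]) (auto simp: q_def[symmetric] l_distr r_distr)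
qed

text \<open>Put \<open>y = 1 - x\<close>, so that \<open>x^n y^n = 0\<close>. A polynomial
  \<open>e\<close> in \<open>x\<close> is divisible by \<open>x^n\<close> while
  \<open>f = 1 - e\<close> is divisible by \<open>y^n\<close>, so \<open>e f = 0\<close> and
  \<open>e\<close> is idempotent. The rest \<open>w = x - e\<close> acts as \<open>- y\<close> on
  the \<open>e\<close>-part and as \<open>x\<close> on the \<open>f\<close>-part, so
  \<open>w^n\<close> kills both.\<close>

lemma strongly_nil_clean_if_sub_square_nilpotent:
  assumes x: "x \<in> carrier R" and nil: "(x \<otimes> (\<one> \<ominus> x)) [^] (n::nat) = \<zero>"
  shows "strongly_nil_clean_elem R x"
proof -
  define y where "y = \<one> \<ominus> x"
  have y: "y \<in> carrier R" and xy: "x \<otimes> y = y \<otimes> x" and x_eq: "x = \<one> \<ominus> y"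
    unfolding y_def by (insert x; algebra)+
  have xn: "x [^] n \<in> carrier R" "x [^] n \<otimes> x = x \<otimes> x [^] n"
    and yn: "y [^] n \<in> carrier R" "y [^] n \<otimes> x = x \<otimes> y [^] n"
    using x y xy by (auto intro!: group_commutes_pow)
  have nil: "x [^] n \<otimes> y [^] n = \<zero>"
    using nil pow_mult_distrib[OF xy x y] by (simp add: y_def)
  obtain p where p: "p \<in> carrier R" "p \<otimes> x = x \<otimes> p"
    "\<one> \<ominus> (\<one> \<ominus> x [^] n) [^] n = x [^] n \<otimes> p"
    using one_minus_one_minus_pow[OF xn(1) x xn(2)] by blast
  obtain q where q: "q \<in> carrier R" "q \<otimes> x = x \<otimes> q" "q \<otimes> y = y \<otimes> q"
    "\<one> \<ominus> (\<one> \<ominus> y) [^] n = y \<otimes> q"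
    using one_minus_one_minus_pow[OF y x xy[symmetric]] by blast
  \<comment> \<open>\<open>e = 1 - (1 - x\<^sup>n)\<^sup>n\<close> is divisible by \<open>x\<^sup>n\<close>, and \<open>1 - e\<close> by \<open>y\<^sup>n\<close> since \<open>y\<close> divides \<open>1 - x\<^sup>n\<close>.\<close>
  define e where "e = x [^] n \<otimes> p"
  define f where "f = \<one> \<ominus> e"
  have e: "e \<in> carrier R" "e \<otimes> x = x \<otimes> e"
  proof -
    have "x [^] n \<otimes> p \<otimes> x = x [^] n \<otimes> x \<otimes> p" using p x xn(1) by (simp add: m_assoc)
    then show "e \<otimes> x = x \<otimes> e" using p x xn by (simp add: e_def m_assoc)
  qed (use p xn in \<open>simp add: e_def\<close>)
  have f: "f \<in> carrier R" "f \<otimes> x = x \<otimes> f" "e \<oplus> f = \<one>"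
    unfolding f_def by (insert e x; algebra)+
  have "f = (\<one> \<ominus> x [^] n) [^] n"
  proof -
    have "(\<one> \<ominus> x [^] n) [^] n \<in> carrier R" using xn by simp
    then show ?thesis unfolding f_def e_def p(3)[symmetric] by algebra
  qed
  also have "\<dots> = (y \<otimes> q) [^] n" using q(4) x_eq by simp
  also have "\<dots> = y [^] n \<otimes> q [^] n" using q y by (intro pow_mult_distrib) auto
  finally have f_eq: "f = y [^] n \<otimes> q [^] n" .
  have "y \<otimes> e = e \<otimes> y" unfolding y_def by (insert e x; algebra)
  then have ey: "e \<otimes> y [^] n = y [^] n \<otimes> e"
    using e y by (intro group_commutes_pow[symmetric]) auto
  have xf: "x [^] n \<otimes> f = \<zero>"
    using xn yn q nil by (simp add: f_eq m_assoc[symmetric])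
  have ye: "y [^] n \<otimes> e = \<zero>"
  proof -
    have "y [^] n \<otimes> x [^] n = x [^] n \<otimes> y [^] n"
      using xn yn x group_commutes_pow[of x "y [^] n" n] by simp
    then have "y [^] n \<otimes> e = x [^] n \<otimes> y [^] n \<otimes> p"
      using xn yn p by (simp add: e_def m_assoc[symmetric])
    then show ?thesis using nil p by simp
  qed
  have ef: "e \<otimes> f = \<zero>"
    unfolding f_eq using e yn q ey ye by (simp add: m_assoc[symmetric])
  have idem: "e \<otimes> e = e"
  proof -
    have "e \<otimes> e = e \<otimes> (e \<oplus> f)" using ef e f(1) by (simp add: r_distr)
    then show ?thesis using f e by simp
  qed
  define w where "w = x \<ominus> e"
  have w: "w \<in> carrier R" unfolding w_def using x e by simp
  have we: "w \<otimes> e = (\<ominus> y) \<otimes> e"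
    unfolding w_def y_def by (insert x e idem; algebra)
  have wf: "w \<otimes> f = x \<otimes> f"
    unfolding w_def f_def by (insert x e idem; algebra)
  have comm: "w \<otimes> e = e \<otimes> w" "w \<otimes> f = f \<otimes> w"
    unfolding w_def f_def by (insert x e idem; algebra)+
  \<comment> \<open>Since \<open>w\<close> commutes with \<open>g\<close>, one factor
    \<open>w\<close> at a time can be moved next to \<open>g\<close> and replaced by
    \<open>z\<close>. The pairs \<open>(g, z)\<close> to come are \<open>(f, x)\<close> and
    \<open>(e, - y)\<close>.\<close>
  have iter: "w [^] k \<otimes> g = z [^] k \<otimes> g"
    if "g \<in> carrier R" "z \<in> carrier R" "w \<otimes> g = z \<otimes> g" "w \<otimes> g = g \<otimes> w" for g z and k :: nat
  proof (induction k)
    case (Suc k)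
    have "w [^] Suc k \<otimes> g = w [^] k \<otimes> g \<otimes> w"
      using that w by (simp add: m_assoc)
    also have "\<dots> = z [^] k \<otimes> (g \<otimes> w)" using Suc that w by (simp add: m_assoc)
    also have "\<dots> = z [^] k \<otimes> (z \<otimes> g)" using that(3,4) by simp
    also have "\<dots> = z [^] Suc k \<otimes> g" using that(1,2) by (simp add: m_assoc)
    finally show ?case .
  qed (use that in simp)
  have "w [^] n \<otimes> f = \<zero>" using iter[OF f(1) x wf comm(2)] xf by simp
  moreover have "w [^] n \<otimes> e = \<zero>"
  proof -
    have "w [^] n \<otimes> e = (\<ominus> y) [^] n \<otimes> e" using y by (intro iter e we comm) simp
    also have "(\<ominus> y) [^] n = (\<ominus> \<one>) [^] n \<otimes> y [^] n"
      using y pow_mult_distrib[of "\<ominus> \<one>" y n] by (simp add: l_minus r_minus)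
    finally show ?thesis using ye e y by (simp add: m_assoc)
  qed
  ultimately have "w [^] n = \<zero>"
    using r_distr[of e f "w [^] n"] e f w by simp
  then have "nilpotent_elem R w" using w by (auto simp: nilpotent_elem_def)
  moreover have "x = e \<oplus> w" unfolding w_def using x e by algebra
  ultimately show ?thesis
    unfolding strongly_nil_clean_elem_def idempotent_elem_def using e idem comm by metis
qed

text \<open>For \<open>x = e + b\<close> one computes \<open>x (1 - x) = b (1 - 2 e - b)\<close>,
  the nilpotent \<open>b\<close> times an element commuting with it.\<close>

lemma sub_square_nilpotent_if_strongly_nil_clean:
  assumes "strongly_nil_clean_elem R x"
  shows "x \<in> carrier R \<and> (\<exists>n::nat. (x \<otimes> (\<one> \<ominus> x)) [^] n = \<zero>)"
proof -
  obtain e b n where eb: "e \<in> carrier R" "e \<otimes> e = e" "b \<in> carrier R" "b [^] (n::nat) = \<zero>"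
    "e \<otimes> b = b \<otimes> e" "x = e \<oplus> b"
    using assms unfolding strongly_nil_clean_elem_def idempotent_elem_def nilpotent_elem_def by blast
  define c where "c = \<one> \<ominus> e \<ominus> e \<ominus> b"
  have c: "c \<in> carrier R" "b \<otimes> c = c \<otimes> b"
    unfolding c_def by (insert eb(1-3,5); algebra)+
  have "x \<otimes> (\<one> \<ominus> x) = b \<otimes> c"
    unfolding c_def eb(6) using eb(1-3,5) by algebra
  then have "(x \<otimes> (\<one> \<ominus> x)) [^] n = \<zero>"
    using eb c pow_mult_distrib[OF c(2)] by simp
  then show ?thesis using eb by blast
qed

section \<open>Fitting decomposition with respect to one element\<close>

text \<open>The hypotheses say that image and kernel of right multiplication by \<open>a^n\<close>
  do not change when \<open>n\<close> is doubled. Hence the ring is the direct sum of these two left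
  ideals; \<open>e\<close> is the component of \<open>1\<close> in the image and \<open>f\<close>
  the one in the kernel.\<close>

lemma fitting_strongly_nil_clean:
  assumes a: "a \<in> carrier R" and n: "n \<ge> (1::nat)"
    and im: "\<exists>y \<in> carrier R. a [^] n = y \<otimes> a [^] (2 * n)"
    and ker: "\<And>z. z \<in> carrier R \<Longrightarrow> z \<otimes> a [^] (2 * n) = \<zero> \<Longrightarrow> z \<otimes> a [^] n = \<zero>"
  shows "\<exists>u \<in> Units R. strongly_nil_clean_elem R (u \<otimes> a)"
proof -
  \<comment> \<open>With one factor split off, \<open>A = a^m a\<close>, so that
    \<open>(y a^m) a = y A = e\<close>: up to \<open>e\<close>, the element \<open>y a^m\<close>
    inverts \<open>a\<close>.\<close>
  obtain m where m: "n = Suc m" using n by (cases n) auto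
  define A where "A = a [^] n"
  have A: "A \<in> carrier R" "A \<otimes> a = a \<otimes> A" and AA: "a [^] (2 * n) = A \<otimes> A"
    unfolding A_def using a nat_pow_mult[of a n n] by (auto simp: mult_2 nat_pow_Suc2[symmetric] simp del: nat_pow_Suc)
  obtain y where y: "y \<in> carrier R" "A = y \<otimes> (A \<otimes> A)"
    using im unfolding AA A_def by blast
  have triv: "z \<otimes> A = \<zero>" if "z \<in> carrier R" "z \<otimes> (A \<otimes> A) = \<zero>" for z
    using ker that unfolding AA A_def by blast
  \<comment> \<open>Image and kernel of right multiplication by \<open>A\<close> meet in
    \<open>0\<close>. Each of \<open>f e = 0\<close>, \<open>a e = e a\<close> and
    \<open>a b = e\<close> is obtained by placing an element in both.\<close>
  have disj: "z = \<zero>" if "z \<in> carrier R" "z \<otimes> A = \<zero>" "t \<in> carrier R" "z = t \<otimes> A" for z t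
    using triv[of t] that A by (simp add: m_assoc)
  define e where "e = y \<otimes> A"
  define f where "f = \<one> \<ominus> e"
  have e: "e \<in> carrier R" and f: "f \<in> carrier R" and ef1: "e \<oplus> f = \<one>"
    unfolding f_def e_def by (insert y(1) A; algebra)+
  have eA: "e \<otimes> A = A" using y A unfolding e_def by (simp add: m_assoc)
  have fA: "f \<otimes> A = \<zero>" unfolding f_def using e A eA by algebra
  have "f \<otimes> e = \<zero>"
  proof (rule disj)
    show "f \<otimes> e \<otimes> A = \<zero>" using e f A eA fA by (simp add: m_assoc)
    show "f \<otimes> e = (f \<otimes> y) \<otimes> A" using e f A y by (simp add: e_def m_assoc)
  qed (use e f y in auto)
  then have idem: "e \<otimes> e = e" using l_distr[of e f e] e f ef1 by simp
  have ae: "a \<otimes> e = e \<otimes> a"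
  proof -
    have "a \<otimes> e \<ominus> e \<otimes> a = \<zero>"
    proof (rule disj)
      have "(a \<otimes> e \<ominus> e \<otimes> a) \<otimes> A = a \<otimes> (e \<otimes> A) \<ominus> e \<otimes> (a \<otimes> A)"
        by (insert a e A(1); algebra)
      also have "\<dots> = a \<otimes> (e \<otimes> A) \<ominus> (e \<otimes> A) \<otimes> a" using a e A by (simp add: m_assoc)
      also have "\<dots> = \<zero>" using eA A a by simp
      finally show "(a \<otimes> e \<ominus> e \<otimes> a) \<otimes> A = \<zero>" .
      have "(a \<otimes> y \<ominus> y \<otimes> a) \<otimes> A = a \<otimes> (y \<otimes> A) \<ominus> y \<otimes> (a \<otimes> A)"
        by (insert a y(1) A(1); algebra)
      also have "\<dots> = a \<otimes> e \<ominus> e \<otimes> a"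
        unfolding e_def A(2)[symmetric] using A(1) y(1) a by (simp add: m_assoc)
      finally show "a \<otimes> e \<ominus> e \<otimes> a = (a \<otimes> y \<ominus> y \<otimes> a) \<otimes> A" by simp
    qed (use a e y in auto)
    then show ?thesis using a e by simp
  qed
  \<comment> \<open>\<open>b\<close> is the inverse of \<open>a \<otimes> e\<close> in the corner ring \<open>e R e\<close>.\<close>
  define b where "b = e \<otimes> y \<otimes> a [^] m \<otimes> e"
  have b: "b \<in> carrier R" "e \<otimes> b = b" "b \<otimes> e = b"
    using a e y(1) idem by (simp_all add: b_def m_assoc) (simp add: m_assoc[symmetric] idem)
  have eAe: "A \<otimes> e = e \<otimes> A"
    unfolding A_def using a e ae by (intro group_commutes_pow) auto
  have ba: "b \<otimes> a = e"
  proof -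
    have "a [^] m \<otimes> a = A" unfolding A_def m by simp
    moreover have "b \<otimes> a = e \<otimes> (y \<otimes> (a [^] m \<otimes> a)) \<otimes> e"
      unfolding b_def using a e y(1) ae by (simp add: m_assoc)
    ultimately have "b \<otimes> a = e \<otimes> (y \<otimes> A) \<otimes> e" by simp
    then show ?thesis using idem e unfolding e_def[symmetric] by simp
  qed
  have ab: "a \<otimes> b = e"
  proof -
    have "a \<otimes> b \<ominus> e = \<zero>"
    proof (rule disj)
      have 1: "(a \<otimes> b \<ominus> e) \<otimes> e = a \<otimes> b \<ominus> e" using a b e idem by (simp add: minus_eq l_distr l_minus m_assoc)
      have "(a \<otimes> b \<ominus> e) \<otimes> a = a \<otimes> (b \<otimes> a) \<ominus> e \<otimes> a" by (insert a b(1) e; algebra)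
      then have 2: "(a \<otimes> b \<ominus> e) \<otimes> a = \<zero>" using ba ae a e by simp
      have "A = a \<otimes> a [^] m" unfolding A_def m using a by (simp only: nat_pow_Suc2)
      then show "(a \<otimes> b \<ominus> e) \<otimes> A = \<zero>" using 2 a b e by (simp add: m_assoc[symmetric])
      show "a \<otimes> b \<ominus> e = ((a \<otimes> b \<ominus> e) \<otimes> y) \<otimes> A"
        using 1 a b e y A by (simp add: m_assoc e_def)
    qed (use a b e y in auto)
    then show ?thesis using a b e by simp
  qed
  have bf: "b \<otimes> f = \<zero>" "f \<otimes> b = \<zero>"
    unfolding f_def by (insert b e; algebra)+
  have ff: "f \<otimes> f = f" "e \<otimes> f = \<zero>" "f \<otimes> e = \<zero>" "f \<otimes> a = a \<otimes> f"
    unfolding f_def by (insert a e idem ae; algebra)+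
  \<comment> \<open>The inverse is taken componentwise: \<open>b\<close> against \<open>a e\<close>
    in the corner of \<open>e\<close>, and \<open>f\<close> against itself in the corner of
    \<open>f\<close>.\<close>
  have inv: "(b \<oplus> f) \<otimes> (a \<otimes> e \<oplus> f) = \<one>" "(a \<otimes> e \<oplus> f) \<otimes> (b \<oplus> f) = \<one>"
  proof -
    have "(b \<oplus> f) \<otimes> (a \<otimes> e \<oplus> f) = (b \<otimes> a) \<otimes> e \<oplus> b \<otimes> f \<oplus> (f \<otimes> a) \<otimes> e \<oplus> f \<otimes> f"
      by (insert a b(1) e f; algebra)
    also have "\<dots> = \<one>" using ba bf ff idem ef1 a e f by (simp add: m_assoc)
    finally show "(b \<oplus> f) \<otimes> (a \<otimes> e \<oplus> f) = \<one>" .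
    have "(a \<otimes> e \<oplus> f) \<otimes> (b \<oplus> f) = a \<otimes> (e \<otimes> b) \<oplus> a \<otimes> (e \<otimes> f) \<oplus> f \<otimes> b \<oplus> f \<otimes> f"
      by (insert a b(1) e f; algebra)
    also have "\<dots> = \<one>" using ab bf ff b ef1 a e f by simp
    finally show "(a \<otimes> e \<oplus> f) \<otimes> (b \<oplus> f) = \<one>" .
  qed
  then have "b \<oplus> f \<in> Units R" using a b e f unfolding Units_def by auto
  moreover have "strongly_nil_clean_elem R ((b \<oplus> f) \<otimes> a)"
    unfolding strongly_nil_clean_elem_def
  proof (intro exI conjI)
    show "idempotent_elem R e" using e idem by (simp add: idempotent_elem_def)
    \<comment> \<open>As \<open>f\<close> and \<open>a\<close> commute, the power contains the
      factor \<open>f A = 0\<close>.\<close>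
    have "(f \<otimes> a) [^] n = f [^] n \<otimes> A"
      unfolding A_def using ff a f by (intro pow_mult_distrib) auto
    also have "f [^] n \<otimes> A = f [^] m \<otimes> (f \<otimes> A)"
      using f A by (simp add: m m_assoc)
    finally show "nilpotent_elem R (f \<otimes> a)"
      using fA f a unfolding nilpotent_elem_def by auto
    show "e \<otimes> (f \<otimes> a) = f \<otimes> a \<otimes> e"
    proof -
      have "e \<otimes> (f \<otimes> a) = (e \<otimes> f) \<otimes> a" "f \<otimes> a \<otimes> e = (f \<otimes> e) \<otimes> a"
        using a e f ae by (simp_all add: m_assoc)
      then show ?thesis using ff a by simp
    qed
    show "(b \<oplus> f) \<otimes> a = e \<oplus> f \<otimes> a" using a b f ba by (simp add: l_distr)
  qed
  ultimately show ?thesis by blast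
qed


section \<open>Lifting units and strong nil-cleanness along a nil kernel\<close>

text \<open>The cofactor \<open>p\<close> of \<open>z\<close> in \<open>1 - (1 - z)^n\<close>, which
  is now \<open>1\<close>, commutes with \<open>z\<close> and is therefore a two-sided
  inverse.\<close>

lemma Units_if_one_minus_nilpotent:
  assumes z: "z \<in> carrier R" and nil: "(\<one> \<ominus> z) [^] (n::nat) = \<zero>"
  shows "z \<in> Units R"
proof -
  obtain p where p: "p \<in> carrier R" "p \<otimes> z = z \<otimes> p" "\<one> \<ominus> (\<one> \<ominus> z) [^] n = z \<otimes> p"
    using one_minus_one_minus_pow[OF z z refl] by blast
  then have "z \<otimes> p = \<one>" using nil by (simp add: minus_eq)
  then show ?thesis using p z unfolding Units_def by auto
qed

text \<open>One product yields a right inverse of \<open>u\<close>, the other a left inverse. In the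
  lifting argument preimages of mutually inverse elements are inverse to each other only up to the
  kernel, so this weaker criterion is what applies.\<close>

lemma Units_if_both_products_Units:
  assumes u: "u \<in> carrier R" and v: "v \<in> carrier R"
    and uv: "u \<otimes> v \<in> Units R" and vu: "v \<otimes> u \<in> Units R"
  shows "u \<in> Units R"
proof -
  define r where "r = v \<otimes> inv (u \<otimes> v)"
  define l where "l = inv (v \<otimes> u) \<otimes> v"
  have carr: "r \<in> carrier R" "l \<in> carrier R" unfolding r_def l_def using u v uv vu by auto
  have r: "u \<otimes> r = \<one>" unfolding r_def using u v uv by (simp add: m_assoc[symmetric])
  have l: "l \<otimes> u = \<one>" unfolding l_def using u v vu by (simp add: m_assoc)
  have "l = r" using inv_unique[OF l r u carr(2) carr(1)] .
  then show ?thesis using carr l r u unfolding Units_def by auto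
qed

end

text \<open>Any preimage \<open>u\<close> of a suitable unit \<open>u'\<close> works. Its products
  with a preimage of the inverse lie over \<open>1\<close> and so are units, and some power of
  \<open>u a (1 - u a)\<close> lies in the nil kernel.\<close>

lemma (in ring_hom_ring) strongly_unit_nil_clean_lift:
  assumes surj: "h ` carrier R = carrier S"
    and nil: "\<And>x. x \<in> carrier R \<Longrightarrow> h x = \<zero>\<^bsub>S\<^esub> \<Longrightarrow> \<exists>n::nat. x [^]\<^bsub>R\<^esub> n = \<zero>\<^bsub>R\<^esub>"
    and S: "strongly_unit_nil_clean S"
  shows "strongly_unit_nil_clean R"
  unfolding strongly_unit_nil_clean_def
proof
  fix a assume a: "a \<in> carrier R"
  have hsub: "h (\<one>\<^bsub>R\<^esub> \<ominus>\<^bsub>R\<^esub> x) = \<one>\<^bsub>S\<^esub> \<ominus>\<^bsub>S\<^esub> h x" if "x \<in> carrier R" for x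
    using that by (simp add: a_minus_def)
  have unit: "x \<in> Units R" if "x \<in> carrier R" "h x = \<one>\<^bsub>S\<^esub>" for x
  proof -
    have "h (\<one>\<^bsub>R\<^esub> \<ominus>\<^bsub>R\<^esub> x) = \<zero>\<^bsub>S\<^esub>" using hsub that by simp
    with nil[of "\<one>\<^bsub>R\<^esub> \<ominus>\<^bsub>R\<^esub> x"] that R.Units_if_one_minus_nilpotent show ?thesis by auto
  qed
  from S a obtain u' where u': "u' \<in> Units S" "strongly_nil_clean_elem S (u' \<otimes>\<^bsub>S\<^esub> h a)"
    unfolding strongly_unit_nil_clean_def using hom_closed by blast
  then obtain v' where v': "u' \<in> carrier S" "v' \<in> carrier S" "u' \<otimes>\<^bsub>S\<^esub> v' = \<one>\<^bsub>S\<^esub>" "v' \<otimes>\<^bsub>S\<^esub> u' = \<one>\<^bsub>S\<^esub>"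
    unfolding Units_def by auto
  then obtain u v where uv: "u \<in> carrier R" "v \<in> carrier R" "h u = u'" "h v = v'"
    using surj by (metis imageE)
  have u: "u \<in> Units R"
    using uv v' by (intro R.Units_if_both_products_Units[of u v] unit) auto
  obtain n where "((u' \<otimes>\<^bsub>S\<^esub> h a) \<otimes>\<^bsub>S\<^esub> (\<one>\<^bsub>S\<^esub> \<ominus>\<^bsub>S\<^esub> (u' \<otimes>\<^bsub>S\<^esub> h a))) [^]\<^bsub>S\<^esub> (n::nat) = \<zero>\<^bsub>S\<^esub>"
    using S.sub_square_nilpotent_if_strongly_nil_clean[OF u'(2)] by blast
  then have "h (((u \<otimes>\<^bsub>R\<^esub> a) \<otimes>\<^bsub>R\<^esub> (\<one>\<^bsub>R\<^esub> \<ominus>\<^bsub>R\<^esub> (u \<otimes>\<^bsub>R\<^esub> a))) [^]\<^bsub>R\<^esub> n) = \<zero>\<^bsub>S\<^esub>"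
    using uv a by (simp add: hsub hom_nat_pow)
  then obtain m where "(((u \<otimes>\<^bsub>R\<^esub> a) \<otimes>\<^bsub>R\<^esub> (\<one>\<^bsub>R\<^esub> \<ominus>\<^bsub>R\<^esub> (u \<otimes>\<^bsub>R\<^esub> a))) [^]\<^bsub>R\<^esub> n) [^]\<^bsub>R\<^esub> (m::nat) = \<zero>\<^bsub>R\<^esub>"
    using nil uv(1) a by (metis R.m_closed R.minus_closed R.nat_pow_closed R.one_closed)
  then have "strongly_nil_clean_elem R (u \<otimes>\<^bsub>R\<^esub> a)"
    using R.strongly_nil_clean_if_sub_square_nilpotent uv(1) a by (simp add: R.nat_pow_pow)
  with u show "\<exists>u\<in>Units R. strongly_nil_clean_elem R (u \<otimes>\<^bsub>R\<^esub> a)" by blast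
qed

section \<open>Chain conditions on left ideals\<close>

definition left_noetherian :: "('a, 'b) ring_scheme \<Rightarrow> bool" where
  "left_noetherian R \<longleftrightarrow>
     (\<forall>C :: nat \<Rightarrow> 'a set. (\<forall>n. left_ideal (C n) R) \<longrightarrow> (\<forall>n. C n \<subseteq> C (Suc n)) \<longrightarrow>
        (\<exists>n. \<forall>m\<ge>n. C m = C n))"

definition left_artinian :: "('a, 'b) ring_scheme \<Rightarrow> bool" where
  "left_artinian R \<longleftrightarrow>
     (\<forall>C :: nat \<Rightarrow> 'a set. (\<forall>n. left_ideal (C n) R) \<longrightarrow> (\<forall>n. C (Suc n) \<subseteq> C n) \<longrightarrow>
        (\<exists>n. \<forall>m\<ge>n. C m = C n))"

lemma (in ring) add_minus_cancel:
  assumes "x \<in> carrier R" "y \<in> carrier R"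
  shows "x \<oplus> y \<ominus> x = y" "x \<oplus> y \<ominus> y = x"
  by (insert assms; algebra)+

text \<open>Negatives come from multiplication by \<open>- 1\<close>, so closure under them is no
  separate condition.\<close>

lemma (in ring) left_idealI:
  assumes "I \<subseteq> carrier R" "\<zero> \<in> I"
    and add: "\<And>x y. x \<in> I \<Longrightarrow> y \<in> I \<Longrightarrow> x \<oplus> y \<in> I"
    and mult: "\<And>r x. r \<in> carrier R \<Longrightarrow> x \<in> I \<Longrightarrow> r \<otimes> x \<in> I"
  shows "left_ideal I R"
proof -
  have "\<ominus> x \<in> I" if "x \<in> I" for x
    using mult[of "\<ominus> \<one>" x] that assms(1) by (auto simp: l_minus)
  then have "subgroup I (add_monoid R)"
    using assms by (intro add.subgroupI) auto
  then show ?thesis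
    using mult by unfold_locales (auto simp: subgroup_def)
qed

lemma (in left_ideal) minus_in: "x \<in> I \<Longrightarrow> y \<in> I \<Longrightarrow> x \<ominus> y \<in> I"
  by (simp add: a_minus_def a_closed a_inv_closed)

lemma (in ring) left_ideal_Int:
  assumes "left_ideal I R" "left_ideal K R"
  shows "left_ideal (I \<inter> K) R"
proof -
  interpret I: left_ideal I R by fact
  interpret K: left_ideal K R by fact
  show ?thesis by (rule left_idealI) (auto simp: I.I_l_closed K.I_l_closed)
qed

lemma set_add_memI:
  fixes R (structure)
  shows "a \<in> I \<Longrightarrow> b \<in> K \<Longrightarrow> a \<oplus> b \<in> I <+> K"
  by (auto simp: set_add_def')

lemma (in ring) left_ideal_set_add:
  assumes "left_ideal I R" "left_ideal K R"
  shows "left_ideal (I <+> K) R"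
proof -
  interpret I: left_ideal I R by fact
  interpret K: left_ideal K R by fact
  show ?thesis
  proof (rule left_idealI)
    show "I <+> K \<subseteq> carrier R" by (auto simp: set_add_def')
    show "\<zero> \<in> I <+> K" using set_add_memI[of \<zero> I \<zero> K R] by simp
  next
    fix x y :: 'a assume "x \<in> I <+> K" "y \<in> I <+> K"
    then obtain a b c d where *: "x = a \<oplus> b" "y = c \<oplus> d" "a \<in> I" "c \<in> I" "b \<in> K" "d \<in> K"
      unfolding set_add_def' by blast
    then have "x \<oplus> y = (a \<oplus> c) \<oplus> (b \<oplus> d)" using I.a_Hcarr K.a_Hcarr by (simp add: a_ac)
    moreover have "a \<oplus> c \<in> I" "b \<oplus> d \<in> K" using * by auto
    ultimately show "x \<oplus> y \<in> I <+> K" by (simp add: set_add_memI)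
  next
    fix r x :: 'a assume "r \<in> carrier R" "x \<in> I <+> K"
    then obtain a b where *: "x = a \<oplus> b" "a \<in> I" "b \<in> K" "r \<in> carrier R"
      unfolding set_add_def' by blast
    then have "r \<otimes> x = r \<otimes> a \<oplus> r \<otimes> b" using I.a_Hcarr K.a_Hcarr by (simp add: r_distr)
    moreover have "r \<otimes> a \<in> I" "r \<otimes> b \<in> K" using * I.I_l_closed K.I_l_closed by auto
    ultimately show "r \<otimes> x \<in> I <+> K" by (simp add: set_add_memI)
  qed
qed

lemma (in ring) left_ideal_subset_set_add:
  assumes "left_ideal I R" "left_ideal K R"
  shows "I \<subseteq> I <+> K" "K \<subseteq> I <+> K"
proof -
  interpret I: left_ideal I R by fact
  interpret K: left_ideal K R by fact
  show "I \<subseteq> I <+> K"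
  proof
    fix x :: 'a assume "x \<in> I"
    then show "x \<in> I <+> K" using set_add_memI[of x I \<zero> K R] by simp
  qed
  show "K \<subseteq> I <+> K"
  proof
    fix x :: 'a assume "x \<in> K"
    then show "x \<in> I <+> K" using set_add_memI[of \<zero> I x K R] by simp
  qed
qed

section \<open>Chain conditions for semisimple rings\<close>

text \<open>The union of the chain has a complement \<open>K\<close>. Write \<open>1 = e + f\<close>
  with \<open>e\<close> in some \<open>C n\<close> and \<open>f\<close> in \<open>K\<close>. For
  \<open>x\<close> in the union, \<open>x - x e = x f\<close> lies in both summands, so
  \<open>x = x e\<close> is already in \<open>C n\<close>.\<close>

lemma (in ring) semisimple_imp_left_noetherian:
  assumes "semisimple_ring R"
  shows "left_noetherian R"
  unfolding left_noetherian_def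
proof (intro allI impI)
  fix C :: "nat \<Rightarrow> 'a set"
  assume C: "\<forall>n. left_ideal (C n) R" and mono: "\<forall>n. C n \<subseteq> C (Suc n)"
  interpret C: left_ideal "C n" R for n using C by blast
  have mono: "C n \<subseteq> C m" if "n \<le> m" for n m using mono that by (simp add: lift_Suc_mono_le)
  have "left_ideal (\<Union>n. C n) R"
  proof (rule left_idealI)
    fix x y assume "x \<in> (\<Union>n. C n)" "y \<in> (\<Union>n. C n)"
    then obtain n m where "x \<in> C n" "y \<in> C m" by blast
    then have "x \<in> C (max n m)" "y \<in> C (max n m)" using mono[of n "max n m"] mono[of m "max n m"] by auto
    then show "x \<oplus> y \<in> (\<Union>n. C n)" by blast
  qed (use C.I_l_closed in auto)
  then obtain K where K: "left_ideal K R" "(\<Union>n. C n) \<inter> K = {\<zero>}" "(\<Union>n. C n) <+> K = carrier R"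
    using assms unfolding semisimple_ring_def by blast
  interpret K: left_ideal K R by fact
  have "\<one> \<in> (\<Union>n. C n) <+> K" using K(3) by simp
  then obtain e f n where ef: "e \<oplus> f = \<one>" "e \<in> C n" "f \<in> K"
    unfolding set_add_def' by auto
  have "x \<in> C n" if "x \<in> C m" "n \<le> m" for x m
  proof -
    have "x \<ominus> x \<otimes> e = x \<otimes> f"
    proof -
      have carr: "x \<in> carrier R" "e \<in> carrier R" "f \<in> carrier R"
        using ef that C.a_Hcarr K.a_Hcarr by blast+
      then have "x = x \<otimes> e \<oplus> x \<otimes> f" using ef(1) r_distr[of e f x] by simp
      then have "x \<ominus> x \<otimes> e = (x \<otimes> e \<oplus> x \<otimes> f) \<ominus> x \<otimes> e" by (rule arg_cong)
      also have "\<dots> = x \<otimes> f" using carr by (simp add: add_minus_cancel)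
      finally show ?thesis .
    qed
    then have "x \<ominus> x \<otimes> e \<in> K" using ef that K.I_l_closed by simp
    moreover have "x \<ominus> x \<otimes> e \<in> C m"
      using ef(2) that mono[of n m] by (intro C.minus_in C.I_l_closed) auto
    ultimately have "x \<ominus> x \<otimes> e = \<zero>" using K(2) by blast
    then have "x = x \<otimes> e" using that ef(2) by simp
    moreover have "x \<otimes> e \<in> C n" using that ef(2) by (intro C.I_l_closed) auto
    ultimately show ?thesis by simp
  qed
  then show "\<exists>n. \<forall>m\<ge>n. C m = C n" using mono by blast
qed

text \<open>The descending chain is turned into an ascending one by collecting what is lost at each
  step; once the ascending chain stands still, nothing more is lost.\<close>

lemma (in ring) semisimple_imp_left_artinian:
  assumes "semisimple_ring R"
  shows "left_artinian R"
  unfolding left_artinian_def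
proof (intro allI impI)
  fix C :: "nat \<Rightarrow> 'a set"
  assume C: "\<forall>n. left_ideal (C n) R" and anti: "\<forall>n. C (Suc n) \<subseteq> C n"
  interpret C: left_ideal "C n" R for n using C by blast
  have "\<forall>n. \<exists>K. left_ideal K R \<and> C (Suc n) \<inter> K = {\<zero>} \<and> C (Suc n) <+> K = carrier R"
    using assms C unfolding semisimple_ring_def by blast
  then obtain K where K: "\<And>n. left_ideal (K n) R" "\<And>n. C (Suc n) \<inter> K n = {\<zero>}"
    "\<And>n. C (Suc n) <+> K n = carrier R" by metis
  interpret K: left_ideal "K n" R for n using K by blast
  \<comment> \<open>\<open>C n\<close> is the direct sum of \<open>C (Suc n)\<close> and \<open>K n \<inter> C n\<close>; the partial sums \<open>M\<close> of the latter
    form an ascending chain with \<open>M n \<inter> C n = 0\<close>.\<close>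
  define M where "M = rec_nat {\<zero>} (\<lambda>n M. M <+> (K n \<inter> C n))"
  have M0: "M 0 = {\<zero>}" and MS: "M (Suc n) = M n <+> (K n \<inter> C n)" for n
    unfolding M_def by auto
  have M: "left_ideal (M n) R" for n
  proof (induction n)
    case 0
    show ?case unfolding M0 by (rule left_idealI) auto
  next
    case (Suc n)
    then show ?case unfolding MS using K C by (intro left_ideal_set_add left_ideal_Int) auto
  qed
  interpret M: left_ideal "M n" R for n by (rule M)
  have sub: "M n \<subseteq> M (Suc n)" "K n \<inter> C n \<subseteq> M (Suc n)" for n
    unfolding MS
    by (rule left_ideal_subset_set_add[OF M left_ideal_Int[OF K(1) C[rule_format]]])+
  \<comment> \<open>Decompose \<open>c = m + d\<close> along \<open>M (Suc n)\<close>. Then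
    \<open>m = c - d\<close> lies in \<open>M n\<close> and \<open>C n\<close>, hence is
    \<open>0\<close>, and \<open>c = d\<close> lies in \<open>C (Suc n)\<close> and its complement
    \<open>K n\<close>.\<close>
  have disj: "M n \<inter> C n \<subseteq> {\<zero>}" for n
  proof (induction n)
    case (Suc n)
    show ?case
    proof
      fix c assume c: "c \<in> M (Suc n) \<inter> C (Suc n)"
      then obtain m d where md: "c = m \<oplus> d" "m \<in> M n" "d \<in> K n" "d \<in> C n"
        unfolding MS set_add_def' by blast
      have "c \<in> C n" using c anti by blast
      then have "c \<ominus> d \<in> C n" using md C.minus_in by blast
      moreover have "c \<ominus> d = m" using md M.a_Hcarr[of m n] C.a_Hcarr[of d n]
        by (simp add: add_minus_cancel)
      ultimately have "m = \<zero>" using md Suc by blast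
      then have "c = d" using md by simp
      then show "c \<in> {\<zero>}" using md c K(2)[of n] by blast
    qed
  qed (simp add: M0)
  have "\<exists>N. \<forall>m\<ge>N. M m = M N"
    using semisimple_imp_left_noetherian[OF assms, unfolded left_noetherian_def, rule_format, of M, OF M sub(1)] .
  then obtain N where N: "\<And>m. m \<ge> N \<Longrightarrow> M m = M N" by blast
  \<comment> \<open>The \<open>K m\<close>-component of an element of \<open>C m\<close> lies in
    \<open>C m\<close> and in \<open>M (Suc m) = M m\<close>, so it vanishes.\<close>
  have stable: "C m = C (Suc m)" if "m \<ge> N" for m
  proof
    show "C m \<subseteq> C (Suc m)"
    proof
      fix x assume x: "x \<in> C m"
      then have "x \<in> C (Suc m) <+> K m" using K(3)[of m] by simp
      then obtain c k where ck: "x = c \<oplus> k" "c \<in> C (Suc m)" "k \<in> K m"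
        unfolding set_add_def' by blast
      have "c \<in> C m" using ck anti by blast
      then have "x \<ominus> c \<in> C m" using x C.minus_in by blast
      moreover have "x \<ominus> c = k" using ck C.a_Hcarr[of c "Suc m"] K.a_Hcarr[of k m]
        by (simp add: add_minus_cancel)
      ultimately have k: "k \<in> C m" by simp
      then have "k \<in> M (Suc m)" using ck(3) sub(2)[of m] by blast
      then have "k \<in> M m" using N[of m] N[of "Suc m"] that by simp
      then have "k = \<zero>" using k disj[of m] by blast
      then show "x \<in> C (Suc m)" using ck by simp
    qed
  qed (use anti in blast)
  have "C m = C N" if "m \<ge> N" for m
    using that
  proof (induction m rule: dec_induct)
    case (step m)
    then show ?case using stable[of m] by simp
  qed simp
  then show "\<exists>n. \<forall>m\<ge>n. C m = C n" by blast
qed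

text \<open>Right multiplication by \<open>a\<close> is an endomorphism of the regular left module,
  so the images \<open>C n\<close> and kernels \<open>K n\<close> of its powers are left ideals,
  descending and ascending respectively. Comparing \<open>n\<close> with \<open>2 * n\<close> beyond
  both thresholds gives the Fitting hypotheses.\<close>

lemma (in ring) strongly_unit_nil_clean_if_chain_conditions:
  assumes noeth: "left_noetherian R" and art: "left_artinian R"
  shows "strongly_unit_nil_clean R"
  unfolding strongly_unit_nil_clean_def
proof
  fix a assume a: "a \<in> carrier R"
  define C where "C n = (\<lambda>x. x \<otimes> a [^] n) ` carrier R" for n :: nat
  define K where "K n = {x \<in> carrier R. x \<otimes> a [^] n = \<zero>}" for n :: nat
  have "left_ideal (C n) R" for n
  proof (rule left_idealI)
    show "\<zero> \<in> C n" unfolding C_def using a by (intro image_eqI[of _ _ \<zero>]) auto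
    show "x \<oplus> y \<in> C n" if "x \<in> C n" "y \<in> C n" for x y
      using that a unfolding C_def by (auto simp: l_distr[symmetric])
    show "r \<otimes> x \<in> C n" if "r \<in> carrier R" "x \<in> C n" for r x
      using that a unfolding C_def by (auto simp: m_assoc[symmetric])
  qed (use a in \<open>auto simp: C_def\<close>)
  moreover have "C (Suc n) \<subseteq> C n" for n
  proof
    fix y assume "y \<in> C (Suc n)"
    then obtain x where "x \<in> carrier R" "y = x \<otimes> (a \<otimes> a [^] n)"
      unfolding C_def using a nat_pow_Suc2 by auto
    then show "y \<in> C n" using a unfolding C_def by (intro image_eqI[of _ _ "x \<otimes> a"]) (auto simp: m_assoc)
  qed
  ultimately obtain n1 where n1: "\<And>m. m \<ge> n1 \<Longrightarrow> C m = C n1"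
    using art unfolding left_artinian_def by blast
  have "left_ideal (K n) R" for n
    by (rule left_idealI) (use a in \<open>auto simp: K_def l_distr m_assoc\<close>)
  moreover have "K n \<subseteq> K (Suc n)" for n
    using a by (auto simp: K_def m_assoc[symmetric])
  ultimately obtain n2 where n2: "\<And>m. m \<ge> n2 \<Longrightarrow> K m = K n2"
    using noeth unfolding left_noetherian_def by blast
  \<comment> \<open>The successor ensures \<open>n \<ge> 1\<close>.\<close>
  define n where "n = Suc (max n1 n2)"
  have CK: "C n = C (2 * n)" "K n = K (2 * n)"
    using n1[of n] n1[of "2 * n"] n2[of n] n2[of "2 * n"] by (auto simp: n_def)
  show "\<exists>u\<in>Units R. strongly_nil_clean_elem R (u \<otimes> a)"
  proof (rule fitting_strongly_nil_clean[OF a, of n])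
    have "a [^] n \<in> C n" unfolding C_def using a by (intro image_eqI[of _ _ \<one>]) auto
    then show "\<exists>y\<in>carrier R. a [^] n = y \<otimes> a [^] (2 * n)" unfolding CK unfolding C_def by blast
    show "z \<otimes> a [^] n = \<zero>" if "z \<in> carrier R" "z \<otimes> a [^] (2 * n) = \<zero>" for z
      using CK(2) that unfolding K_def by blast
  qed (simp add: n_def)
qed

section \<open>Group rings of finite groups\<close>

lemma (in abelian_monoid) finsum_swap:
  assumes "finite A" "finite B" "\<And>x y. x \<in> A \<Longrightarrow> y \<in> B \<Longrightarrow> f x y \<in> carrier G"
  shows "(\<Oplus>x\<in>A. \<Oplus>y\<in>B. f x y) = (\<Oplus>y\<in>B. \<Oplus>x\<in>A. f x y)"
  using assms(1,3)
proof (induction A rule: finite_induct)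
  case empty
  then show ?case by simp
next
  case (insert a A)
  have "(\<Oplus>x\<in>insert a A. \<Oplus>y\<in>B. f x y) = (\<Oplus>y\<in>B. f a y) \<oplus> (\<Oplus>x\<in>A. \<Oplus>y\<in>B. f x y)"
    using insert by (intro finsum_insert) (auto intro!: finsum_closed)
  also have "\<dots> = (\<Oplus>y\<in>B. f a y \<oplus> (\<Oplus>x\<in>A. f x y))"
    using insert by (subst finsum_addf) (auto intro!: finsum_closed)
  also have "\<dots> = (\<Oplus>y\<in>B. \<Oplus>x\<in>insert a A. f x y)"
    using insert by (intro finsum_cong' refl) (auto intro!: finsum_closed simp: Pi_def)
  finally show ?case .
qed

text \<open>For finite \<open>G\<close> the support condition is void, so every coefficient function
  into \<open>R\<close> counts, and convolutions can be summed over all of \<open>G\<close>.\<close>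

locale finite_group_ring = ring R + G: group G
  for R :: "('a, 'b) ring_scheme" (structure) and G :: "('g, 'h) monoid_scheme" +
  assumes finite_G: "finite (carrier G)"
begin

abbreviation S where "S \<equiv> group_ring R G"

text \<open>The formal monomial \<open>r k\<close>. Taking \<open>k\<close> neutral embeds the
  coefficient ring, and left multiplication by such a monomial scales all coefficients.\<close>

definition group_ring_monom :: "'a \<Rightarrow> 'g \<Rightarrow> 'g \<Rightarrow> 'a" where
  "group_ring_monom r k = (\<lambda>x\<in>carrier G. if x = k then r else \<zero>)"

lemma carrier_S: "carrier S = carrier G \<rightarrow>\<^sub>E carrier R"
  using finite_G by (auto simp: group_ring_def group_ring_supp_def)

lemma coeff_closed [simp, intro]: "f \<in> carrier S \<Longrightarrow> x \<in> carrier G \<Longrightarrow> f x \<in> carrier R"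
  by (auto simp: carrier_S)

lemma carrier_SI:
  "(\<And>x. x \<in> carrier G \<Longrightarrow> F x \<in> carrier R) \<Longrightarrow> (\<lambda>x\<in>carrier G. F x) \<in> carrier S"
  by (simp add: carrier_S)

lemma S_eqI:
  "f \<in> carrier S \<Longrightarrow> g \<in> carrier S \<Longrightarrow> (\<And>x. x \<in> carrier G \<Longrightarrow> f x = g x) \<Longrightarrow> f = g"
  unfolding carrier_S by (rule PiE_ext)

lemma add_coeff [simp]: "x \<in> carrier G \<Longrightarrow> (f \<oplus>\<^bsub>S\<^esub> g) x = f x \<oplus> g x"
  by (simp add: group_ring_def)

lemma zero_coeff [simp]: "x \<in> carrier G \<Longrightarrow> \<zero>\<^bsub>S\<^esub> x = \<zero>"
  by (simp add: group_ring_def)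

lemma one_S: "\<one>\<^bsub>S\<^esub> = group_ring_monom \<one> \<one>\<^bsub>G\<^esub>"
  by (simp add: group_ring_def group_ring_monom_def)

lemma group_ring_monom_coeff: "x \<in> carrier G \<Longrightarrow> group_ring_monom r k x = (if x = k then r else \<zero>)"
  by (simp add: group_ring_monom_def)

lemma mult_coeff:
  assumes "f \<in> carrier S" "g \<in> carrier S" "x \<in> carrier G"
  shows "(f \<otimes>\<^bsub>S\<^esub> g) x = (\<Oplus>y\<in>carrier G. f y \<otimes> g (inv\<^bsub>G\<^esub> y \<otimes>\<^bsub>G\<^esub> x))"
proof -
  have "(f \<otimes>\<^bsub>S\<^esub> g) x = (\<Oplus>y\<in>group_ring_supp R G f. f y \<otimes> g (inv\<^bsub>G\<^esub> y \<otimes>\<^bsub>G\<^esub> x))"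
    using assms by (simp add: group_ring_def)
  also have "\<dots> = (\<Oplus>y\<in>carrier G. f y \<otimes> g (inv\<^bsub>G\<^esub> y \<otimes>\<^bsub>G\<^esub> x))"
    using assms finite_G
    by (intro add.finprod_mono_neutral_cong_left) (auto simp: group_ring_supp_def)
  finally show ?thesis .
qed

lemma S_closed [simp, intro]:
  "f \<in> carrier S \<Longrightarrow> g \<in> carrier S \<Longrightarrow> f \<oplus>\<^bsub>S\<^esub> g \<in> carrier S"
  "f \<in> carrier S \<Longrightarrow> g \<in> carrier S \<Longrightarrow> f \<otimes>\<^bsub>S\<^esub> g \<in> carrier S"
  "\<zero>\<^bsub>S\<^esub> \<in> carrier S" "\<one>\<^bsub>S\<^esub> \<in> carrier S"
  "r \<in> carrier R \<Longrightarrow> group_ring_monom r k \<in> carrier S"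
proof -
  show "f \<otimes>\<^bsub>S\<^esub> g \<in> carrier S" if "f \<in> carrier S" "g \<in> carrier S"
  proof -
    have "(f \<otimes>\<^bsub>S\<^esub> g) x \<in> carrier R" if "x \<in> carrier G" for x
      using mult_coeff that \<open>f \<in> carrier S\<close> \<open>g \<in> carrier S\<close> by (auto intro!: finsum_closed)
    moreover have "f \<otimes>\<^bsub>S\<^esub> g \<in> extensional (carrier G)" by (simp add: group_ring_def)
    ultimately show ?thesis unfolding carrier_S by (auto simp: PiE_def)
  qed
  show "f \<oplus>\<^bsub>S\<^esub> g \<in> carrier S" if "f \<in> carrier S" "g \<in> carrier S"
    using that unfolding carrier_S by (auto simp: group_ring_def)
  show "r \<in> carrier R \<Longrightarrow> group_ring_monom r k \<in> carrier S"
    unfolding group_ring_monom_def by (rule carrier_SI) auto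
  show "\<one>\<^bsub>S\<^esub> \<in> carrier S" unfolding one_S group_ring_monom_def by (rule carrier_SI) auto
  show "\<zero>\<^bsub>S\<^esub> \<in> carrier S" unfolding carrier_S by (simp add: group_ring_def)
qed

text \<open>Left translation by an inverse permutes \<open>G\<close>. This supplies the change of
  variable in the associativity law.\<close>

lemma finsum_translate:
  assumes z: "z \<in> carrier G" and F: "\<And>w. w \<in> carrier G \<Longrightarrow> F w \<in> carrier R"
  shows "(\<Oplus>w\<in>carrier G. F w) = (\<Oplus>y\<in>carrier G. F (inv\<^bsub>G\<^esub> z \<otimes>\<^bsub>G\<^esub> y))"
proof -
  have "(\<lambda>y. inv\<^bsub>G\<^esub> z \<otimes>\<^bsub>G\<^esub> y) ` carrier G = carrier G"
    using z by (intro G.surj_const_mult) simp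
  moreover have "inj_on (\<lambda>y. inv\<^bsub>G\<^esub> z \<otimes>\<^bsub>G\<^esub> y) (carrier G)"
    using z by (intro G.inj_on_cmult) simp
  ultimately show ?thesis
    using finsum_reindex[of F "\<lambda>y. inv\<^bsub>G\<^esub> z \<otimes>\<^bsub>G\<^esub> y" "carrier G"] F by simp
qed

lemma mult_assoc_S:
  assumes f: "f \<in> carrier S" and g: "g \<in> carrier S" and h: "h \<in> carrier S"
  shows "(f \<otimes>\<^bsub>S\<^esub> g) \<otimes>\<^bsub>S\<^esub> h = f \<otimes>\<^bsub>S\<^esub> (g \<otimes>\<^bsub>S\<^esub> h)"
proof (rule S_eqI)
  fix x assume x: "x \<in> carrier G"
  \<comment> \<open>Both bracketings have the double sum of \<open>T\<close> as coefficient. They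
    differ in the order of summation and in a shift of the inner index by \<open>z\<close>.\<close>
  define T where "T y z = f z \<otimes> (g (inv\<^bsub>G\<^esub> z \<otimes>\<^bsub>G\<^esub> y) \<otimes> h (inv\<^bsub>G\<^esub> y \<otimes>\<^bsub>G\<^esub> x))" for y z
  have T: "T y z \<in> carrier R" if "y \<in> carrier G" "z \<in> carrier G" for y z
    using that x f g h by (auto simp: T_def)
  have "((f \<otimes>\<^bsub>S\<^esub> g) \<otimes>\<^bsub>S\<^esub> h) x = (\<Oplus>y\<in>carrier G. \<Oplus>z\<in>carrier G. T y z)"
    unfolding mult_coeff[OF S_closed(2)[OF f g] h x]
  proof (intro finsum_cong' refl)
    fix y assume y: "y \<in> carrier G"
    have "(f \<otimes>\<^bsub>S\<^esub> g) y \<otimes> h (inv\<^bsub>G\<^esub> y \<otimes>\<^bsub>G\<^esub> x)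
      = (\<Oplus>z\<in>carrier G. f z \<otimes> g (inv\<^bsub>G\<^esub> z \<otimes>\<^bsub>G\<^esub> y) \<otimes> h (inv\<^bsub>G\<^esub> y \<otimes>\<^bsub>G\<^esub> x))"
      unfolding mult_coeff[OF f g y]
      by (rule finsum_ldistr) (use x y f g h finite_G in auto)
    also have "\<dots> = (\<Oplus>z\<in>carrier G. T y z)"
      using x y f g h by (intro finsum_cong' refl) (auto simp: T_def m_assoc)
    finally show "(f \<otimes>\<^bsub>S\<^esub> g) y \<otimes> h (inv\<^bsub>G\<^esub> y \<otimes>\<^bsub>G\<^esub> x) = (\<Oplus>z\<in>carrier G. T y z)" .
  qed (use T in \<open>auto intro!: finsum_closed\<close>)
  also have "\<dots> = (\<Oplus>z\<in>carrier G. \<Oplus>y\<in>carrier G. T y z)"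
    using T finite_G by (intro finsum_swap) auto
  also have "\<dots> = (f \<otimes>\<^bsub>S\<^esub> (g \<otimes>\<^bsub>S\<^esub> h)) x"
    unfolding mult_coeff[OF f S_closed(2)[OF g h] x]
  proof (intro finsum_cong' refl)
    fix z assume z: "z \<in> carrier G"
    then have zx: "inv\<^bsub>G\<^esub> z \<otimes>\<^bsub>G\<^esub> x \<in> carrier G" using x by simp
    have "(g \<otimes>\<^bsub>S\<^esub> h) (inv\<^bsub>G\<^esub> z \<otimes>\<^bsub>G\<^esub> x) =
      (\<Oplus>y\<in>carrier G. g (inv\<^bsub>G\<^esub> z \<otimes>\<^bsub>G\<^esub> y) \<otimes> h (inv\<^bsub>G\<^esub> (inv\<^bsub>G\<^esub> z \<otimes>\<^bsub>G\<^esub> y) \<otimes>\<^bsub>G\<^esub> (inv\<^bsub>G\<^esub> z \<otimes>\<^bsub>G\<^esub> x)))"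
      unfolding mult_coeff[OF g h zx]
      by (rule finsum_translate[OF z]) (use g h zx in auto)
    also have "\<dots> = (\<Oplus>y\<in>carrier G. g (inv\<^bsub>G\<^esub> z \<otimes>\<^bsub>G\<^esub> y) \<otimes> h (inv\<^bsub>G\<^esub> y \<otimes>\<^bsub>G\<^esub> x))"
    proof (intro finsum_cong' refl)
      fix y assume y: "y \<in> carrier G"
      have "z \<otimes>\<^bsub>G\<^esub> (inv\<^bsub>G\<^esub> z \<otimes>\<^bsub>G\<^esub> x) = x"
        using x z by (simp add: G.m_assoc[symmetric])
      then have "inv\<^bsub>G\<^esub> (inv\<^bsub>G\<^esub> z \<otimes>\<^bsub>G\<^esub> y) \<otimes>\<^bsub>G\<^esub> (inv\<^bsub>G\<^esub> z \<otimes>\<^bsub>G\<^esub> x) = inv\<^bsub>G\<^esub> y \<otimes>\<^bsub>G\<^esub> x"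
        using x y z by (simp add: G.inv_mult_group G.m_assoc)
      then show "g (inv\<^bsub>G\<^esub> z \<otimes>\<^bsub>G\<^esub> y) \<otimes> h (inv\<^bsub>G\<^esub> (inv\<^bsub>G\<^esub> z \<otimes>\<^bsub>G\<^esub> y) \<otimes>\<^bsub>G\<^esub> (inv\<^bsub>G\<^esub> z \<otimes>\<^bsub>G\<^esub> x))
        = g (inv\<^bsub>G\<^esub> z \<otimes>\<^bsub>G\<^esub> y) \<otimes> h (inv\<^bsub>G\<^esub> y \<otimes>\<^bsub>G\<^esub> x)" by simp
    qed (use x z g h in auto)
    finally show "(\<Oplus>y\<in>carrier G. T y z) = f z \<otimes> (g \<otimes>\<^bsub>S\<^esub> h) (inv\<^bsub>G\<^esub> z \<otimes>\<^bsub>G\<^esub> x)"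
      unfolding T_def using x z f g h finite_G by (subst finsum_rdistr[symmetric]) auto
  qed (use x f g h in auto)
  finally show "((f \<otimes>\<^bsub>S\<^esub> g) \<otimes>\<^bsub>S\<^esub> h) x = (f \<otimes>\<^bsub>S\<^esub> (g \<otimes>\<^bsub>S\<^esub> h)) x" .
qed (use assms in auto)

lemma group_ring_monom_mult_coeff:
  assumes r: "r \<in> carrier R" and k: "k \<in> carrier G" and f: "f \<in> carrier S" and x: "x \<in> carrier G"
  shows "(group_ring_monom r k \<otimes>\<^bsub>S\<^esub> f) x = r \<otimes> f (inv\<^bsub>G\<^esub> k \<otimes>\<^bsub>G\<^esub> x)"
proof -
  have "(group_ring_monom r k \<otimes>\<^bsub>S\<^esub> f) x
    = (\<Oplus>y\<in>carrier G. if k = y then r \<otimes> f (inv\<^bsub>G\<^esub> y \<otimes>\<^bsub>G\<^esub> x) else \<zero>)"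
    unfolding mult_coeff[OF S_closed(5)[OF r] f x]
    using assms by (intro finsum_cong' refl) (auto simp: group_ring_monom_coeff)
  also have "\<dots> = r \<otimes> f (inv\<^bsub>G\<^esub> k \<otimes>\<^bsub>G\<^esub> x)"
    using assms finite_G by (intro finsum_singleton) auto
  finally show ?thesis .
qed

lemma ring_S: "ring S"
proof (rule ringI)
  show "abelian_group S"
  proof (rule abelian_groupI)
    fix f assume f: "f \<in> carrier S"
    let ?g = "\<lambda>x\<in>carrier G. \<ominus> f x"
    have "?g \<in> carrier S" using f by (intro carrier_SI) auto
    moreover have "?g \<oplus>\<^bsub>S\<^esub> f = \<zero>\<^bsub>S\<^esub>" using f calculation by (intro S_eqI) (auto simp: l_neg)
    ultimately show "\<exists>g\<in>carrier S. g \<oplus>\<^bsub>S\<^esub> f = \<zero>\<^bsub>S\<^esub>" by blast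
  qed (auto intro: S_eqI simp: a_ac)
  show "monoid S"
  proof (rule monoidI)
    fix f assume f: "f \<in> carrier S"
    show "\<one>\<^bsub>S\<^esub> \<otimes>\<^bsub>S\<^esub> f = f"
      using f by (intro S_eqI) (auto simp: one_S group_ring_monom_mult_coeff)
    show "f \<otimes>\<^bsub>S\<^esub> \<one>\<^bsub>S\<^esub> = f"
    proof (rule S_eqI)
      fix x assume x: "x \<in> carrier G"
      have "(f \<otimes>\<^bsub>S\<^esub> \<one>\<^bsub>S\<^esub>) x = (\<Oplus>y\<in>carrier G. if x = y then f y else \<zero>)"
        unfolding mult_coeff[OF f S_closed(4) x]
      proof (intro finsum_cong' refl)
        fix y assume y: "y \<in> carrier G"
        have "inv\<^bsub>G\<^esub> y \<otimes>\<^bsub>G\<^esub> x = \<one>\<^bsub>G\<^esub> \<longleftrightarrow> x = y"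
          using x y G.inv_solve_left'[of "\<one>\<^bsub>G\<^esub>" y x] by auto
        then show "f y \<otimes> \<one>\<^bsub>S\<^esub> (inv\<^bsub>G\<^esub> y \<otimes>\<^bsub>G\<^esub> x) = (if x = y then f y else \<zero>)"
          using f x y by (simp add: one_S group_ring_monom_coeff)
      qed (use f x in auto)
      also have "\<dots> = f x" using f x finite_G by (intro finsum_singleton) auto
      finally show "(f \<otimes>\<^bsub>S\<^esub> \<one>\<^bsub>S\<^esub>) x = f x" .
    qed (use f in auto)
  qed (auto simp: mult_assoc_S)
  show "(f \<oplus>\<^bsub>S\<^esub> g) \<otimes>\<^bsub>S\<^esub> h = f \<otimes>\<^bsub>S\<^esub> h \<oplus>\<^bsub>S\<^esub> g \<otimes>\<^bsub>S\<^esub> h"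
    if "f \<in> carrier S" "g \<in> carrier S" "h \<in> carrier S" for f g h
  proof (rule S_eqI)
    fix x assume x: "x \<in> carrier G"
    show "((f \<oplus>\<^bsub>S\<^esub> g) \<otimes>\<^bsub>S\<^esub> h) x = (f \<otimes>\<^bsub>S\<^esub> h \<oplus>\<^bsub>S\<^esub> g \<otimes>\<^bsub>S\<^esub> h) x"
    proof -
      have "((f \<oplus>\<^bsub>S\<^esub> g) \<otimes>\<^bsub>S\<^esub> h) x = (\<Oplus>y\<in>carrier G. f y \<otimes> h (inv\<^bsub>G\<^esub> y \<otimes>\<^bsub>G\<^esub> x) \<oplus> g y \<otimes> h (inv\<^bsub>G\<^esub> y \<otimes>\<^bsub>G\<^esub> x))"
        unfolding mult_coeff[OF S_closed(1)[OF that(1,2)] that(3) x]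
        by (rule finsum_cong') (use that x in \<open>auto simp: l_distr\<close>)
      then show ?thesis
        using that x by (subst (asm) finsum_addf) (auto simp: mult_coeff)
    qed
  qed (use that in auto)
  show "h \<otimes>\<^bsub>S\<^esub> (f \<oplus>\<^bsub>S\<^esub> g) = h \<otimes>\<^bsub>S\<^esub> f \<oplus>\<^bsub>S\<^esub> h \<otimes>\<^bsub>S\<^esub> g"
    if "f \<in> carrier S" "g \<in> carrier S" "h \<in> carrier S" for f g h
  proof (rule S_eqI)
    fix x assume x: "x \<in> carrier G"
    show "(h \<otimes>\<^bsub>S\<^esub> (f \<oplus>\<^bsub>S\<^esub> g)) x = (h \<otimes>\<^bsub>S\<^esub> f \<oplus>\<^bsub>S\<^esub> h \<otimes>\<^bsub>S\<^esub> g) x"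
    proof -
      have "(h \<otimes>\<^bsub>S\<^esub> (f \<oplus>\<^bsub>S\<^esub> g)) x = (\<Oplus>y\<in>carrier G. h y \<otimes> f (inv\<^bsub>G\<^esub> y \<otimes>\<^bsub>G\<^esub> x) \<oplus> h y \<otimes> g (inv\<^bsub>G\<^esub> y \<otimes>\<^bsub>G\<^esub> x))"
        unfolding mult_coeff[OF that(3) S_closed(1)[OF that(1,2)] x]
        by (rule finsum_cong') (use that x in \<open>auto simp: r_distr\<close>)
      then show ?thesis
        using that x by (subst (asm) finsum_addf) (auto simp: mult_coeff)
    qed
  qed (use that in auto)
qed

end

section \<open>Chain conditions for group rings of finite groups\<close>

lemma eventually_const_uniform:
  fixes F :: "nat \<Rightarrow> nat \<Rightarrow> 'c"
  assumes "\<And>k. k < n \<Longrightarrow> \<exists>N. \<forall>m\<ge>N. F k m = F k N"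
  shows "\<exists>N. \<forall>m\<ge>N. \<forall>k<n. F k m = F k N"
proof -
  obtain N where N: "\<And>k m. k < n \<Longrightarrow> m \<ge> N k \<Longrightarrow> F k m = F k (N k)"
    using assms by metis
  \<comment> \<open>The sum of the thresholds bounds each of them and also makes sense for
    \<open>n = 0\<close>.\<close>
  have "F k m = F k (\<Sum>k<n. N k)" if "k < n" "m \<ge> (\<Sum>k<n. N k)" for k m
  proof -
    have "N k \<le> (\<Sum>k<n. N k)" using that by (intro member_le_sum) auto
    then show ?thesis using N[of k m] N[of k "\<Sum>k<n. N k"] that by simp
  qed
  then show ?thesis by blast
qed

context finite_group_ring
begin

interpretation S: ring S by (rule ring_S)

text \<open>With \<open>G\<close> listed as \<open>h 0, h 1, ...\<close>, the functions vanishing at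
  the first \<open>k\<close> places filter the group ring by left \<open>R\<close>-submodules. This
  set is the image in \<open>R\<close> of the \<open>k\<close>-th layer of \<open>M\<close>, in
  analogy to the leading coefficient ideals of Hilbert's basis theorem.\<close>

definition leading_coeffs :: "(nat \<Rightarrow> 'g) \<Rightarrow> nat \<Rightarrow> ('g \<Rightarrow> 'a) set \<Rightarrow> 'a set" where
  "leading_coeffs h k M = {f (h k) | f. f \<in> M \<and> (\<forall>i<k. f (h i) = \<zero>)}"

lemma leading_coeffs_mono: "M \<subseteq> M' \<Longrightarrow> leading_coeffs h k M \<subseteq> leading_coeffs h k M'"
  by (auto simp: leading_coeffs_def)

text \<open>A scalar \<open>r\<close> acts through the monomial at the neutral element, which
  multiplies every coefficient by \<open>r\<close> on the left and so preserves the vanishing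
  conditions.\<close>

lemma left_ideal_leading_coeffs:
  assumes M: "left_ideal M S" and h: "\<And>i. i \<le> k \<Longrightarrow> h i \<in> carrier G"
  shows "left_ideal (leading_coeffs h k M) R"
proof -
  interpret M: left_ideal M S by fact
  have MS: "f \<in> carrier S" if "f \<in> M" for f using that by (rule M.a_Hcarr)
  show ?thesis
  proof (rule left_idealI)
    show "leading_coeffs h k M \<subseteq> carrier R"
      using h MS by (auto simp: leading_coeffs_def)
    show "\<zero> \<in> leading_coeffs h k M"
      unfolding leading_coeffs_def using h M.zero_closed
      by (auto intro!: exI[of _ "\<zero>\<^bsub>S\<^esub>"])
  next
    fix x y assume "x \<in> leading_coeffs h k M" "y \<in> leading_coeffs h k M"
    then obtain f g where "x = f (h k)" "y = g (h k)" "f \<in> M" "g \<in> M"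
      "\<forall>i<k. f (h i) = \<zero>" "\<forall>i<k. g (h i) = \<zero>"
      unfolding leading_coeffs_def by blast
    then show "x \<oplus> y \<in> leading_coeffs h k M"
      unfolding leading_coeffs_def using h M.a_closed by (auto intro!: exI[of _ "f \<oplus>\<^bsub>S\<^esub> g"])
  next
    fix r x assume r: "r \<in> carrier R" and "x \<in> leading_coeffs h k M"
    then obtain f where f: "x = f (h k)" "f \<in> M" "\<forall>i<k. f (h i) = \<zero>"
      unfolding leading_coeffs_def by blast
    have "(group_ring_monom r \<one>\<^bsub>G\<^esub> \<otimes>\<^bsub>S\<^esub> f) (h i) = r \<otimes> f (h i)" if "i \<le> k" for i
      using group_ring_monom_mult_coeff[OF r G.one_closed MS[OF f(2)] h[OF that]] h[OF that] by simp
    moreover have "group_ring_monom r \<one>\<^bsub>G\<^esub> \<otimes>\<^bsub>S\<^esub> f \<in> M" using r f(2) by (intro M.I_l_closed) auto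
    ultimately show "r \<otimes> x \<in> leading_coeffs h k M"
      unfolding leading_coeffs_def using f r by (auto intro!: exI[of _ "group_ring_monom r \<one>\<^bsub>G\<^esub> \<otimes>\<^bsub>S\<^esub> f"])
  qed
qed

text \<open>Successive approximation of \<open>f\<close> in \<open>M'\<close> by elements
  \<open>g\<close> of \<open>M\<close>: if they agree at the first \<open>k\<close> places, the next
  coefficient of \<open>f - g\<close> is a leading coefficient of \<open>M'\<close>, hence of
  \<open>M\<close>, and adding an element of \<open>M\<close> that realises it gives agreement at
  one more place.\<close>

lemma left_ideal_eq_if_leading_coeffs_eq:
  assumes h: "h ` {..<n} = carrier G"
    and M: "left_ideal M S" and M': "left_ideal M' S" and sub: "M \<subseteq> M'"
    and eq: "\<And>k. k < n \<Longrightarrow> leading_coeffs h k M = leading_coeffs h k M'"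
  shows "M = M'"
proof
  interpret M: left_ideal M S by fact
  interpret M': left_ideal M' S by fact
  have hG: "h i \<in> carrier G" if "i < n" for i using h that by blast
  show "M' \<subseteq> M"
  proof
    fix f assume f: "f \<in> M'"
    have "\<exists>g\<in>M. \<forall>i<k. f (h i) = g (h i)" if "k \<le> n" for k
      using that
    proof (induction k)
      case 0
      then show ?case using M.zero_closed by blast
    next
      case (Suc k)
      then obtain g where g: "g \<in> M" "\<forall>i<k. f (h i) = g (h i)" by auto
      define d where "d = f \<ominus>\<^bsub>S\<^esub> g"
      have gS: "g \<in> carrier S" and d: "d \<in> M'" and dS: "d \<in> carrier S"
        using g(1) f sub unfolding d_def by (auto intro: M'.minus_in)
      have fd: "f = d \<oplus>\<^bsub>S\<^esub> g"
        unfolding d_def using f gS by (simp add: S.minus_eq S.a_assoc S.l_neg)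
      then have f_h: "f (h i) = d (h i) \<oplus> g (h i)" if "i < n" for i
        using hG[OF that] by simp
      have "d (h i) = \<zero>" if "i < k" for i
      proof -
        have hi: "h i \<in> carrier G" and "f (h i) = g (h i)" using hG g(2) that Suc.prems by auto
        then have "d (h i) \<oplus> g (h i) = \<zero> \<oplus> g (h i)" using f_h[of i] that Suc.prems gS by simp
        then show ?thesis using hi gS dS by (simp only: add.right_cancel coeff_closed zero_closed)
      qed
      then have "d (h k) \<in> leading_coeffs h k M"
        using d eq[of k] Suc.prems unfolding leading_coeffs_def by auto
      then obtain g' where g': "g' \<in> M" "d (h k) = g' (h k)" "\<forall>i<k. g' (h i) = \<zero>"
        unfolding leading_coeffs_def by blast
      have "f (h i) = (g' \<oplus>\<^bsub>S\<^esub> g) (h i)" if "i < Suc k" for i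
      proof -
        have "d (h i) = g' (h i)"
          using g'(2,3) \<open>\<And>i. i < k \<Longrightarrow> d (h i) = \<zero>\<close> that by (cases "i = k") auto
        then show ?thesis using f_h[of i] hG[of i] that Suc.prems by simp
      qed
      then show ?case using g(1) g'(1) by blast
    qed
    then obtain g where g: "g \<in> M" "\<forall>i<n. f (h i) = g (h i)" by blast
    have "f = g"
    proof (rule S_eqI)
      show "f x = g x" if "x \<in> carrier G" for x
        using that g(2) unfolding h[symmetric] by auto
    qed (use f g(1) in auto)
    then show "f \<in> M" using g(1) by simp
  qed
qed (rule sub)

lemma ex_enumeration: "\<exists>h n. h ` {..<n :: nat} = carrier G"
  using finite_G finite_imp_nat_seg_image_inj_on by (metis lessThan_def)

text \<open>Each of the finitely many layers gives an ascending chain in \<open>R\<close>. Once all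
  of them are constant, so is the chain in the group ring. The Artinian case is the same with
  inclusions reversed.\<close>

lemma left_noetherian_S:
  assumes "left_noetherian R"
  shows "left_noetherian S"
  unfolding left_noetherian_def
proof (intro allI impI)
  fix C :: "nat \<Rightarrow> ('g \<Rightarrow> 'a) set"
  assume C: "\<forall>n. left_ideal (C n) S" and mono: "\<forall>n. C n \<subseteq> C (Suc n)"
  obtain h and n :: nat where h: "h ` {..<n} = carrier G" using ex_enumeration by blast
  then have hG: "h i \<in> carrier G" if "i < n" for i using that by blast
  have "\<exists>N. \<forall>m\<ge>N. leading_coeffs h k (C m) = leading_coeffs h k (C N)" if "k < n" for k
  proof (rule assms[unfolded left_noetherian_def, rule_format, of "\<lambda>m. leading_coeffs h k (C m)"])
    show "left_ideal (leading_coeffs h k (C m)) R" for m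
      using that by (intro left_ideal_leading_coeffs C[rule_format] hG) simp
    show "leading_coeffs h k (C m) \<subseteq> leading_coeffs h k (C (Suc m))" for m
      by (intro leading_coeffs_mono mono[rule_format])
  qed
  from eventually_const_uniform[of n "\<lambda>k m. leading_coeffs h k (C m)", OF this]
  obtain N where N: "\<forall>m\<ge>N. \<forall>k<n. leading_coeffs h k (C m) = leading_coeffs h k (C N)" by blast
  have "C m = C N" if "m \<ge> N" for m
  proof (rule sym, rule left_ideal_eq_if_leading_coeffs_eq[OF h])
    show "C N \<subseteq> C m" using lift_Suc_mono_le[of C N m] mono that by blast
    show "leading_coeffs h k (C N) = leading_coeffs h k (C m)" if "k < n" for k
      using N \<open>m \<ge> N\<close> that by metis
  qed (rule C[rule_format])+
  then show "\<exists>N. \<forall>m\<ge>N. C m = C N" by blast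
qed

lemma left_artinian_S:
  assumes "left_artinian R"
  shows "left_artinian S"
  unfolding left_artinian_def
proof (intro allI impI)
  fix C :: "nat \<Rightarrow> ('g \<Rightarrow> 'a) set"
  assume C: "\<forall>n. left_ideal (C n) S" and anti: "\<forall>n. C (Suc n) \<subseteq> C n"
  obtain h and n :: nat where h: "h ` {..<n} = carrier G" using ex_enumeration by blast
  then have hG: "h i \<in> carrier G" if "i < n" for i using that by blast
  have "\<exists>N. \<forall>m\<ge>N. leading_coeffs h k (C m) = leading_coeffs h k (C N)" if "k < n" for k
  proof (rule assms[unfolded left_artinian_def, rule_format, of "\<lambda>m. leading_coeffs h k (C m)"])
    show "left_ideal (leading_coeffs h k (C m)) R" for m
      using that by (intro left_ideal_leading_coeffs C[rule_format] hG) simp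
    show "leading_coeffs h k (C (Suc m)) \<subseteq> leading_coeffs h k (C m)" for m
      by (intro leading_coeffs_mono anti[rule_format])
  qed
  from eventually_const_uniform[of n "\<lambda>k m. leading_coeffs h k (C m)", OF this]
  obtain N where N: "\<forall>m\<ge>N. \<forall>k<n. leading_coeffs h k (C m) = leading_coeffs h k (C N)" by blast
  have "C m = C N" if "m \<ge> N" for m
  proof (rule left_ideal_eq_if_leading_coeffs_eq[OF h])
    show "C m \<subseteq> C N" using lift_Suc_antimono_le[of C N m] anti that by blast
    show "leading_coeffs h k (C m) = leading_coeffs h k (C N)" if "k < n" for k
      using N \<open>m \<ge> N\<close> that by metis
  qed (rule C[rule_format])+
  then show "\<exists>N. \<forall>m\<ge>N. C m = C N" by blast
qed

text \<open>The coefficients of \<open>f^n\<close> are sums of \<open>n\<close>-fold products of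
  coefficients of \<open>f\<close>, and all such products vanish for the right
  \<open>n\<close>.\<close>

lemma nilpotent_if_nilpotent_rng_coeffs:
  assumes f: "f \<in> carrier S" and nil: "nilpotent_rng R (generate_rng R (f ` carrier G))"
  shows "\<exists>n::nat. f [^]\<^bsub>S\<^esub> n = \<zero>\<^bsub>S\<^esub>"
proof -
  let ?T = "generate_rng R (f ` carrier G)"
  obtain n where n: "\<And>xs. set xs \<subseteq> ?T \<Longrightarrow> length xs = n \<Longrightarrow> foldr (\<otimes>) xs \<one> = \<zero>"
    using nil unfolding nilpotent_rng_def by blast
  have T: "x \<in> carrier R" if "x \<in> ?T" for x
    using that by (induction rule: generate_rng.induct) (use f in auto)
  have prod: "foldr (\<otimes>) xs \<one> \<in> carrier R" if "set xs \<subseteq> ?T" for xs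
    using that by (induction xs) (auto intro: T)
  \<comment> \<open>The induction trades factors of the list for powers of \<open>f\<close>: a
    coefficient of \<open>f^k\<close> kills all products of \<open>n - k\<close> elements. At
    \<open>k = 0\<close> this is the hypothesis; at \<open>k = n\<close> the list is empty.\<close>
  have "\<forall>x\<in>carrier G. \<forall>xs. set xs \<subseteq> ?T \<and> length xs + k = n \<longrightarrow>
      (f [^]\<^bsub>S\<^esub> k) x \<otimes> foldr (\<otimes>) xs \<one> = \<zero>" for k :: nat
  proof (induction k)
    case 0
    then show ?case using n by auto
  next
    case (Suc k)
    show ?case
    proof (intro ballI allI impI)
      fix x xs assume x: "x \<in> carrier G" and xs: "set xs \<subseteq> ?T \<and> length xs + Suc k = n"
      have "(f [^]\<^bsub>S\<^esub> Suc k) x \<otimes> foldr (\<otimes>) xs \<one>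
        = (\<Oplus>y\<in>carrier G. (f [^]\<^bsub>S\<^esub> k) y \<otimes> f (inv\<^bsub>G\<^esub> y \<otimes>\<^bsub>G\<^esub> x)) \<otimes> foldr (\<otimes>) xs \<one>"
        using f x by (simp add: mult_coeff)
      also have "\<dots> = (\<Oplus>y\<in>carrier G. (f [^]\<^bsub>S\<^esub> k) y \<otimes> f (inv\<^bsub>G\<^esub> y \<otimes>\<^bsub>G\<^esub> x) \<otimes> foldr (\<otimes>) xs \<one>)"
        using f x xs prod finite_G by (intro finsum_ldistr) auto
      also have "\<dots> = (\<Oplus>y\<in>carrier G. \<zero>)"
      proof (rule finsum_cong')
        fix y assume y: "y \<in> carrier G"
        have "f (inv\<^bsub>G\<^esub> y \<otimes>\<^bsub>G\<^esub> x) \<in> ?T" using x y by (intro generate_rng.incl) auto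
        then have "(f [^]\<^bsub>S\<^esub> k) y \<otimes> foldr (\<otimes>) (f (inv\<^bsub>G\<^esub> y \<otimes>\<^bsub>G\<^esub> x) # xs) \<one> = \<zero>"
          using xs Suc[THEN bspec, OF y, THEN spec, of "f (inv\<^bsub>G\<^esub> y \<otimes>\<^bsub>G\<^esub> x) # xs"] by auto
        then show "(f [^]\<^bsub>S\<^esub> k) y \<otimes> f (inv\<^bsub>G\<^esub> y \<otimes>\<^bsub>G\<^esub> x) \<otimes> foldr (\<otimes>) xs \<one> = \<zero>"
          using f x y xs prod by (simp add: m_assoc)
      qed auto
      finally show "(f [^]\<^bsub>S\<^esub> Suc k) x \<otimes> foldr (\<otimes>) xs \<one> = \<zero>" by simp
    qed
  qed
  from this[of n] have "(f [^]\<^bsub>S\<^esub> n) x = \<zero>" if "x \<in> carrier G" for x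
    using that f S.nat_pow_closed[OF f, of n] by (auto dest: bspec[OF _ that] spec[of _ "[]"])
  then have "f [^]\<^bsub>S\<^esub> n = \<zero>\<^bsub>S\<^esub>" using f by (intro S_eqI) auto
  then show ?thesis by blast
qed

end

section \<open>Coefficients modulo the radical\<close>

lemma group_ring_map_hom:
  assumes "ring_hom_ring R Q \<phi>" "group G" "finite (carrier G)"
  shows "ring_hom_ring (group_ring R G) (group_ring Q G) (\<lambda>f. \<lambda>x\<in>carrier G. \<phi> (f x))"
proof -
  interpret \<phi>: ring_hom_ring R Q \<phi> by fact
  interpret G: group G by fact
  interpret R: finite_group_ring R G by unfold_locales (rule assms(3))
  interpret Q: finite_group_ring Q G by unfold_locales (rule assms(3))
  let ?\<Phi> = "\<lambda>f. \<lambda>x\<in>carrier G. \<phi> (f x)"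
  have closed: "?\<Phi> f \<in> carrier Q.S" if "f \<in> carrier R.S" for f
    using that by (intro Q.carrier_SI) auto
  show ?thesis
  proof (rule ring_hom_ringI[OF R.ring_S Q.ring_S closed])
    fix f g assume f: "f \<in> carrier R.S" and g: "g \<in> carrier R.S"
    show "?\<Phi> (f \<oplus>\<^bsub>R.S\<^esub> g) = ?\<Phi> f \<oplus>\<^bsub>Q.S\<^esub> ?\<Phi> g"
    proof (rule Q.S_eqI)
      show "?\<Phi> (f \<oplus>\<^bsub>R.S\<^esub> g) x = (?\<Phi> f \<oplus>\<^bsub>Q.S\<^esub> ?\<Phi> g) x" if "x \<in> carrier G" for x
        using that f g by simp
    qed (intro closed R.S_closed Q.S_closed f g)+
    show "?\<Phi> (f \<otimes>\<^bsub>R.S\<^esub> g) = ?\<Phi> f \<otimes>\<^bsub>Q.S\<^esub> ?\<Phi> g"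
    proof (rule Q.S_eqI)
      fix x assume x: "x \<in> carrier G"
      have "?\<Phi> (f \<otimes>\<^bsub>R.S\<^esub> g) x = \<phi> (\<Oplus>\<^bsub>R\<^esub>y\<in>carrier G. f y \<otimes>\<^bsub>R\<^esub> g (inv\<^bsub>G\<^esub> y \<otimes>\<^bsub>G\<^esub> x))"
        using x by (simp add: R.mult_coeff[OF f g x])
      also have "\<dots> = (\<Oplus>\<^bsub>Q\<^esub>y\<in>carrier G. (\<phi> \<circ> (\<lambda>y. f y \<otimes>\<^bsub>R\<^esub> g (inv\<^bsub>G\<^esub> y \<otimes>\<^bsub>G\<^esub> x))) y)"
        by (rule \<phi>.hom_finsum) (use f g x in auto)
      also have "\<dots> = (\<Oplus>\<^bsub>Q\<^esub>y\<in>carrier G. ?\<Phi> f y \<otimes>\<^bsub>Q\<^esub> ?\<Phi> g (inv\<^bsub>G\<^esub> y \<otimes>\<^bsub>G\<^esub> x))"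
        by (rule \<phi>.S.finsum_cong') (use f g x in auto)
      also have "\<dots> = (?\<Phi> f \<otimes>\<^bsub>Q.S\<^esub> ?\<Phi> g) x"
        by (rule Q.mult_coeff[OF closed[OF f] closed[OF g] x, symmetric])
      finally show "?\<Phi> (f \<otimes>\<^bsub>R.S\<^esub> g) x = (?\<Phi> f \<otimes>\<^bsub>Q.S\<^esub> ?\<Phi> g) x" .
    qed (intro closed R.S_closed Q.S_closed f g)+
  next
    show "?\<Phi> \<one>\<^bsub>R.S\<^esub> = \<one>\<^bsub>Q.S\<^esub>"
      unfolding R.one_S Q.one_S R.group_ring_monom_def Q.group_ring_monom_def by (rule restrict_ext) auto
  qed
qed

text \<open>An intersection of maximal left ideals is directly seen to be a left ideal only;
  two-sidedness is derived afterwards from the quotient being a ring.\<close>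

lemma (in ring) left_ideal_jacobson_radical: "left_ideal (jacobson_radical R) R"
proof (rule left_idealI)
  have M: "left_ideal M R" if "maximal_left_ideal M R" for M
    using that by (simp add: maximal_left_ideal_def)
  have add: "additive_subgroup M R" if "maximal_left_ideal M R" for M
    using M[OF that] by (rule left_ideal.axioms(1))
  show "\<zero> \<in> jacobson_radical R"
    using additive_subgroup.zero_closed[OF add] by (simp add: jacobson_radical_def)
  show "x \<oplus> y \<in> jacobson_radical R" if "x \<in> jacobson_radical R" "y \<in> jacobson_radical R" for x y
    using that additive_subgroup.a_closed[OF add] by (simp add: jacobson_radical_def)
  show "r \<otimes> x \<in> jacobson_radical R" if "r \<in> carrier R" "x \<in> jacobson_radical R" for r x
    using that left_ideal.I_l_closed[OF M] by (simp add: jacobson_radical_def)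
qed (auto simp: jacobson_radical_def)

text \<open>For a left ideal \<open>I\<close> the product \<open>(I + 1) (I + x)\<close> of cosets contains \<open>x\<close> and \<open>j x + x\<close>
  for all \<open>j \<in> I\<close>, so it is a single coset only if \<open>I x \<subseteq> I\<close>.\<close>

lemma (in ring) ideal_if_ring_Quot:
  assumes I: "left_ideal I R" and Q: "ring (R Quot I)"
  shows "ideal I R"
proof (rule idealI)
  interpret I: left_ideal I R by fact
  show "subgroup I (add_monoid R)" by (rule I.a_subgroup)
  show "x \<otimes> a \<in> I" if "a \<in> I" "x \<in> carrier R" for a x using that by (rule I.I_l_closed)
  show "a \<otimes> x \<in> I" if a: "a \<in> I" and x: "x \<in> carrier R" for a x
  proof -
    have "(I +> \<one>) \<otimes>\<^bsub>R Quot I\<^esub> (I +> x) \<in> carrier (R Quot I)"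
      using x by (intro monoid.m_closed ring.is_monoid Q) (auto simp: FactRing_def A_RCOSETS_def')
    then obtain c where c: "c \<in> carrier R" "(\<Union>u\<in>I +> \<one>. \<Union>v\<in>I +> x. I +> u \<otimes> v) = I +> c"
      by (auto simp: FactRing_def rcoset_mult_def A_RCOSETS_def')
    have mem: "j \<oplus> y \<in> I +> y" if "j \<in> I" for j y
      using that by (auto simp: a_r_coset_def')
    have self: "y \<in> I +> y" if "y \<in> carrier R" for y
      using mem[OF I.zero_closed, of y] that by simp
    have 1: "u \<otimes> v \<in> I +> c" if "u \<in> I +> \<one>" "v \<in> I +> x" "u \<in> carrier R" "v \<in> carrier R" for u v
      using that c(2) self[of "u \<otimes> v"] by blast
    have "\<one> \<otimes> x \<in> I +> c" using x by (intro 1 self) auto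
    then obtain i where i: "i \<in> I" "x = i \<oplus> c" using x by (auto simp: a_r_coset_def')
    have "(a \<oplus> \<one>) \<otimes> x \<in> I +> c" using a x by (intro 1 self mem) auto
    then obtain j where j: "j \<in> I" "(a \<oplus> \<one>) \<otimes> x = j \<oplus> c" by (auto simp: a_r_coset_def')
    have carr: "a \<in> carrier R" "i \<in> carrier R" "j \<in> carrier R" using a i j by auto
    have "a \<otimes> x = (a \<oplus> \<one>) \<otimes> x \<ominus> x" by (insert carr x; algebra)
    also have "\<dots> = (j \<oplus> c) \<ominus> (i \<oplus> c)" using j(2) i(2) by simp
    also have "\<dots> = j \<ominus> i" by (insert carr c(1); algebra)
    finally show ?thesis using i(1) j(1) I.minus_in by simp
  qed
qed (rule ring_axioms)

lemma strongly_unit_nil_clean_group_ring_finite: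
  assumes R: "ring R" and semi: "semilocal_ring R"
    and nil: "locally_nilpotent R (jacobson_radical R)"
    and G: "group G" "finite (carrier G)"
  shows "strongly_unit_nil_clean (group_ring R G)"
proof -
  interpret R: ring R by fact
  define J where "J = jacobson_radical R"
  define Q where "Q = R Quot J"
  have semi: "semisimple_ring Q" using semi by (simp add: semilocal_ring_def J_def Q_def)
  then have Q: "ring Q" by (simp add: semisimple_ring_def)
  \<comment> \<open>Semisimplicity of the quotient includes its being a ring, which makes the
    radical two-sided and the coset map a homomorphism.\<close>
  then interpret J: ideal J R
    unfolding Q_def J_def by (intro R.ideal_if_ring_Quot R.left_ideal_jacobson_radical)
  define \<phi> where "\<phi> x = J +>\<^bsub>R\<^esub> x" for x
  have \<phi>: "ring_hom_ring R Q \<phi>"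
    using J.rcos_ring_hom_ring unfolding \<phi>_def Q_def .
  interpret Q: ring Q by fact
  interpret G: group G by fact
  interpret RG: finite_group_ring R G by unfold_locales (rule G)
  interpret QG: finite_group_ring Q G by unfold_locales (rule G)
  let ?\<Phi> = "\<lambda>f. \<lambda>x\<in>carrier G. \<phi> (f x)"
  interpret \<Phi>: ring_hom_ring RG.S QG.S ?\<Phi>
    using \<phi> G by (rule group_ring_map_hom)
  show ?thesis
  proof (rule \<Phi>.strongly_unit_nil_clean_lift)
    show "?\<Phi> ` carrier RG.S = carrier QG.S"
    proof (intro equalityI subsetI)
      fix g assume g: "g \<in> carrier QG.S"
      have "\<forall>x\<in>carrier G. \<exists>r\<in>carrier R. g x = \<phi> r"
        using g QG.coeff_closed[OF g] by (auto simp: Q_def FactRing_def A_RCOSETS_def' \<phi>_def)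
      then have "\<exists>s. \<forall>x\<in>carrier G. s x \<in> carrier R \<and> g x = \<phi> (s x)"
        by (intro bchoice) blast
      then obtain s where s: "\<And>x. x \<in> carrier G \<Longrightarrow> s x \<in> carrier R \<and> g x = \<phi> (s x)" by blast
      let ?f = "\<lambda>x\<in>carrier G. s x"
      have f: "?f \<in> carrier RG.S" using s by (intro RG.carrier_SI) auto
      have "g = ?\<Phi> ?f" by (rule QG.S_eqI[OF g \<Phi>.hom_closed[OF f]]) (use s in simp)
      then show "g \<in> ?\<Phi> ` carrier RG.S" using f by (rule image_eqI)
    qed (erule imageE, simp only: \<Phi>.hom_closed)
  next
    fix f assume f: "f \<in> carrier RG.S" and 0: "?\<Phi> f = \<zero>\<^bsub>QG.S\<^esub>"
    have "f x \<in> J" if x: "x \<in> carrier G" for x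
    proof -
      have "\<phi> (f x) = \<zero>\<^bsub>Q\<^esub>" using fun_cong[OF 0, of x] x by simp
      then have "J +>\<^bsub>R\<^esub> f x = J" by (simp add: \<phi>_def Q_def FactRing_def)
      then show ?thesis using J.a_rcos_self[of "f x"] f x by auto
    qed
    \<comment> \<open>A kernel element has all its coefficients in the radical. They are finite in
      number, so local nilpotence applies to them.\<close>
    then have "f ` carrier G \<subseteq> jacobson_radical R" unfolding J_def by auto
    then have "nilpotent_rng R (generate_rng R (f ` carrier G))"
      using nil G(2) by (simp add: locally_nilpotent_def)
    then show "\<exists>n::nat. f [^]\<^bsub>RG.S\<^esub> n = \<zero>\<^bsub>RG.S\<^esub>"
      by (rule RG.nilpotent_if_nilpotent_rng_coeffs[OF f])
  next
    show "strongly_unit_nil_clean QG.S"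
      using QG.left_noetherian_S[OF Q.semisimple_imp_left_noetherian[OF semi]]
        QG.left_artinian_S[OF Q.semisimple_imp_left_artinian[OF semi]]
      by (rule ring.strongly_unit_nil_clean_if_chain_conditions[OF QG.ring_S])
  qed
qed

section \<open>Group rings of subgroups\<close>

text \<open>The embedding of \<open>RH\<close> into \<open>RG\<close>. It is not an inclusion of
  sets: an element of \<open>RH\<close> is \<open>undefined\<close> outside \<open>H\<close>, where
  its image has to be zero.\<close>

definition extend_coeffs ::
    "('a, 'b) ring_scheme \<Rightarrow> ('g, 'h) monoid_scheme \<Rightarrow> 'g set \<Rightarrow> ('g \<Rightarrow> 'a) \<Rightarrow> 'g \<Rightarrow> 'a" where
  "extend_coeffs R G H f = (\<lambda>x\<in>carrier G. if x \<in> H then f x else \<zero>\<^bsub>R\<^esub>)"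

text \<open>Extension by zero leaves the support unchanged, so the products in both group rings are
  sums over the same index set.\<close>

lemma extend_coeffs_hom:
  assumes R: "ring R" and G: "group G" and H: "subgroup H G" and fin: "finite H"
  defines "S \<equiv> group_ring R (G\<lparr>carrier := H\<rparr>)" and "T \<equiv> group_ring R G"
    and "\<iota> \<equiv> extend_coeffs R G H"
  shows "f \<in> carrier S \<Longrightarrow> \<iota> f \<in> carrier T"
    and "f \<in> carrier S \<Longrightarrow> g \<in> carrier S \<Longrightarrow> \<iota> (f \<otimes>\<^bsub>S\<^esub> g) = \<iota> f \<otimes>\<^bsub>T\<^esub> \<iota> g"
    and "\<iota> (f \<oplus>\<^bsub>S\<^esub> g) = \<iota> f \<oplus>\<^bsub>T\<^esub> \<iota> g"
    and "\<iota> \<one>\<^bsub>S\<^esub> = \<one>\<^bsub>T\<^esub>" and "\<iota> \<zero>\<^bsub>S\<^esub> = \<zero>\<^bsub>T\<^esub>"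
proof -
  interpret R: ring R by fact
  interpret G: group G by fact
  interpret H: subgroup H G by fact
  have supp: "group_ring_supp R G (\<iota> f) = group_ring_supp R (G\<lparr>carrier := H\<rparr>) f" for f
    by (auto simp: group_ring_supp_def \<iota>_def extend_coeffs_def)
  show "\<iota> f \<in> carrier T" if "f \<in> carrier S"
  proof -
    have "finite (group_ring_supp R G (\<iota> f))"
      unfolding supp using fin by (simp add: group_ring_supp_def)
    moreover have "\<iota> f \<in> carrier G \<rightarrow>\<^sub>E carrier R"
      using that by (auto simp: S_def group_ring_def \<iota>_def extend_coeffs_def)
    ultimately show ?thesis by (simp add: T_def group_ring_def)
  qed
  show "\<iota> (f \<oplus>\<^bsub>S\<^esub> g) = \<iota> f \<oplus>\<^bsub>T\<^esub> \<iota> g"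
    by (auto simp: S_def T_def group_ring_def \<iota>_def extend_coeffs_def fun_eq_iff)
  show "\<iota> \<one>\<^bsub>S\<^esub> = \<one>\<^bsub>T\<^esub>" "\<iota> \<zero>\<^bsub>S\<^esub> = \<zero>\<^bsub>T\<^esub>"
    by (auto simp: S_def T_def group_ring_def \<iota>_def extend_coeffs_def fun_eq_iff)
  show "\<iota> (f \<otimes>\<^bsub>S\<^esub> g) = \<iota> f \<otimes>\<^bsub>T\<^esub> \<iota> g" if "f \<in> carrier S" "g \<in> carrier S"
  proof
    fix x
    let ?A = "group_ring_supp R (G\<lparr>carrier := H\<rparr>) f"
    have AH: "?A \<subseteq> H" by (auto simp: group_ring_supp_def)
    have coeff: "f y \<in> carrier R" "g y \<in> carrier R" if "y \<in> H" for y
      using that \<open>f \<in> carrier S\<close> \<open>g \<in> carrier S\<close> by (auto simp: S_def group_ring_def)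
    \<comment> \<open>For \<open>y\<close> in the support, the quotient of \<open>x\<close> by
      \<open>y\<close> is in \<open>H\<close> exactly when \<open>x\<close> is. So the summands
      agree for \<open>x\<close> in \<open>H\<close> and vanish for other \<open>x\<close> in
      \<open>G\<close>; off \<open>G\<close> both sides are \<open>undefined\<close>.\<close>
    consider "x \<in> H" | "x \<in> carrier G" "x \<notin> H" | "x \<notin> carrier G" by blast
    then show "\<iota> (f \<otimes>\<^bsub>S\<^esub> g) x = (\<iota> f \<otimes>\<^bsub>T\<^esub> \<iota> g) x"
    proof cases
      case 1
      have "(\<Oplus>\<^bsub>R\<^esub>y\<in>?A. f y \<otimes>\<^bsub>R\<^esub> g (inv\<^bsub>G\<lparr>carrier := H\<rparr>\<^esub> y \<otimes>\<^bsub>G\<^esub> x))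
        = (\<Oplus>\<^bsub>R\<^esub>y\<in>?A. \<iota> f y \<otimes>\<^bsub>R\<^esub> \<iota> g (inv\<^bsub>G\<^esub> y \<otimes>\<^bsub>G\<^esub> x))"
      proof (rule R.finsum_cong'[OF refl])
        fix y assume "y \<in> ?A"
        then have y: "y \<in> H" using AH by blast
        then have "inv\<^bsub>G\<^esub> y \<otimes>\<^bsub>G\<^esub> x \<in> H" using 1 by auto
        then show "f y \<otimes>\<^bsub>R\<^esub> g (inv\<^bsub>G\<lparr>carrier := H\<rparr>\<^esub> y \<otimes>\<^bsub>G\<^esub> x) = \<iota> f y \<otimes>\<^bsub>R\<^esub> \<iota> g (inv\<^bsub>G\<^esub> y \<otimes>\<^bsub>G\<^esub> x)"
          using y 1 G.m_inv_consistent[OF H y] by (simp add: \<iota>_def extend_coeffs_def)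
      qed (use AH coeff 1 in \<open>auto simp: \<iota>_def extend_coeffs_def\<close>)
      then show ?thesis using 1
        by (simp add: S_def T_def group_ring_def supp[unfolded \<iota>_def] \<iota>_def extend_coeffs_def[of R G H "restrict _ _"])
    next
      case 2
      have "(\<Oplus>\<^bsub>R\<^esub>y\<in>?A. \<iota> f y \<otimes>\<^bsub>R\<^esub> \<iota> g (inv\<^bsub>G\<^esub> y \<otimes>\<^bsub>G\<^esub> x)) = (\<Oplus>\<^bsub>R\<^esub>y\<in>?A. \<zero>\<^bsub>R\<^esub>)"
      proof (rule R.finsum_cong'[OF refl])
        fix y assume "y \<in> ?A"
        then have y: "y \<in> H" using AH by blast
        have "inv\<^bsub>G\<^esub> y \<otimes>\<^bsub>G\<^esub> x \<notin> H"
        proof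
          assume "inv\<^bsub>G\<^esub> y \<otimes>\<^bsub>G\<^esub> x \<in> H"
          then have "y \<otimes>\<^bsub>G\<^esub> (inv\<^bsub>G\<^esub> y \<otimes>\<^bsub>G\<^esub> x) \<in> H" using y by blast
          then show False using 2 y by (simp add: G.m_assoc[symmetric])
        qed
        then show "\<iota> f y \<otimes>\<^bsub>R\<^esub> \<iota> g (inv\<^bsub>G\<^esub> y \<otimes>\<^bsub>G\<^esub> x) = \<zero>\<^bsub>R\<^esub>"
          using y 2 coeff by (simp add: \<iota>_def extend_coeffs_def)
      qed auto
      then have "(\<iota> f \<otimes>\<^bsub>T\<^esub> \<iota> g) x = \<zero>\<^bsub>R\<^esub>"
        using 2 by (simp add: T_def group_ring_def supp)
      then show ?thesis using 2 by (simp add: \<iota>_def extend_coeffs_def)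
    next
      case 3
      then show ?thesis by (simp add: T_def group_ring_def \<iota>_def extend_coeffs_def)
    qed
  qed
qed

section \<open>Reduction to a finite subgroup\<close>

theorem proposition4p16:
  fixes R :: "('a, 'b) ring_scheme" and G :: "('g, 'h) monoid_scheme"
  assumes "ring R" and "semilocal_ring R"
    and "locally_nilpotent R (jacobson_radical R)"
    and "group G" and "locally_finite_group G"
  shows "strongly_unit_nil_clean (group_ring R G)"
  unfolding strongly_unit_nil_clean_def
proof
  let ?T = "group_ring R G"
  interpret G: group G by fact
  fix a assume a: "a \<in> carrier ?T"
  \<comment> \<open>The support is finite, so local finiteness makes \<open>H\<close> finite, and
    \<open>a\<close> comes from \<open>RH\<close>.\<close>
  define H where "H = generate G (group_ring_supp R G a)"
  have supp: "finite (group_ring_supp R G a)" "group_ring_supp R G a \<subseteq> carrier G"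
    using a by (auto simp: group_ring_def group_ring_supp_def)
  then have H: "subgroup H G" "finite H"
    using assms(5) G.generate_is_subgroup unfolding H_def by (simp_all add: locally_finite_group_def)
  let ?S = "group_ring R (G\<lparr>carrier := H\<rparr>)" and ?\<iota> = "extend_coeffs R G H"
  note \<iota> = extend_coeffs_hom[OF \<open>ring R\<close> \<open>group G\<close> H]
  interpret RH: finite_group_ring R "G\<lparr>carrier := H\<rparr>"
    using assms(1) G.subgroup_imp_group[OF H(1)] H(2)
    by (simp add: finite_group_ring_def finite_group_ring_axioms_def)
  interpret S: ring ?S by (rule RH.ring_S)
  \<comment> \<open>Powers are transported by the rules for products and \<open>1\<close> alone. All
    facts about \<open>?T\<close> are obtained in this way from equations in
    \<open>?S\<close>.\<close>
  have pow: "?\<iota> (f [^]\<^bsub>?S\<^esub> (n::nat)) = ?\<iota> f [^]\<^bsub>?T\<^esub> n" if "f \<in> carrier ?S" for f n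
  proof (induction n)
    case (Suc n)
    then show ?case using \<iota>(2)[OF S.nat_pow_closed[OF that] that] by simp
  qed (simp add: \<iota>(4))
  define a' where "a' = restrict a H"
  have a': "a' \<in> carrier ?S"
    unfolding a'_def RH.carrier_S using a subgroup.subset[OF H(1)] by (auto simp: group_ring_def)
  \<comment> \<open>Outside \<open>H\<close> the coefficients of \<open>a\<close> are zero because
    \<open>H\<close> contains the support.\<close>
  have \<iota>a': "?\<iota> a' = a"
  proof
    show "?\<iota> a' x = a x" for x
    proof (cases "x \<in> carrier G")
      case True
      then have "a x = \<zero>\<^bsub>R\<^esub>" if "x \<notin> H"
        using that generate.incl[of x "group_ring_supp R G a" G]
        unfolding H_def by (auto simp: group_ring_supp_def)
      then show ?thesis using True by (auto simp: extend_coeffs_def a'_def)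
    next
      case False
      moreover have "a \<in> carrier G \<rightarrow>\<^sub>E carrier R" using a by (simp add: group_ring_def)
      ultimately show ?thesis using PiE_arb[of a] by (simp add: extend_coeffs_def)
    qed
  qed
  have "strongly_unit_nil_clean ?S"
    using assms(1-3) G.subgroup_imp_group[OF H(1)] H(2)
    by (intro strongly_unit_nil_clean_group_ring_finite) simp_all
  then obtain u where u: "u \<in> Units ?S" "strongly_nil_clean_elem ?S (u \<otimes>\<^bsub>?S\<^esub> a')"
    using a' unfolding strongly_unit_nil_clean_def by blast
  then obtain v where uv: "u \<in> carrier ?S" "v \<in> carrier ?S"
    "u \<otimes>\<^bsub>?S\<^esub> v = \<one>\<^bsub>?S\<^esub>" "v \<otimes>\<^bsub>?S\<^esub> u = \<one>\<^bsub>?S\<^esub>"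
    unfolding Units_def by auto
  obtain e b n where eb: "e \<in> carrier ?S" "e \<otimes>\<^bsub>?S\<^esub> e = e" "b \<in> carrier ?S"
    "b [^]\<^bsub>?S\<^esub> (n::nat) = \<zero>\<^bsub>?S\<^esub>" "e \<otimes>\<^bsub>?S\<^esub> b = b \<otimes>\<^bsub>?S\<^esub> e" "u \<otimes>\<^bsub>?S\<^esub> a' = e \<oplus>\<^bsub>?S\<^esub> b"
    using u(2) unfolding strongly_nil_clean_elem_def idempotent_elem_def nilpotent_elem_def by blast
  have "?\<iota> u \<in> Units ?T"
    unfolding Units_def using \<iota>(1)[OF uv(1)] \<iota>(1)[OF uv(2)]
      \<iota>(2)[OF uv(1,2)] \<iota>(2)[OF uv(2,1)] uv(3,4) \<iota>(4) by auto
  moreover have "strongly_nil_clean_elem ?T (?\<iota> u \<otimes>\<^bsub>?T\<^esub> a)"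
    unfolding strongly_nil_clean_elem_def
  proof (intro exI conjI)
    show "idempotent_elem ?T (?\<iota> e)"
      using \<iota>(1)[OF eb(1)] \<iota>(2)[OF eb(1,1)] eb(2) by (simp add: idempotent_elem_def)
    show "nilpotent_elem ?T (?\<iota> b)"
      using \<iota>(1)[OF eb(3)] pow[OF eb(3), of n] eb(4) \<iota>(5) by (auto simp: nilpotent_elem_def)
    show "?\<iota> e \<otimes>\<^bsub>?T\<^esub> ?\<iota> b = ?\<iota> b \<otimes>\<^bsub>?T\<^esub> ?\<iota> e"
      using \<iota>(2)[OF eb(1,3)] \<iota>(2)[OF eb(3,1)] eb(5) by simp
    show "?\<iota> u \<otimes>\<^bsub>?T\<^esub> a = ?\<iota> e \<oplus>\<^bsub>?T\<^esub> ?\<iota> b"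
      using \<iota>(2)[OF uv(1) a'] \<iota>(3)[of e b] eb(6) \<iota>a' by simp
  qed
  ultimately show "\<exists>u\<in>Units ?T. strongly_nil_clean_elem ?T (u \<otimes>\<^bsub>?T\<^esub> a)" by blast
qed

end
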